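(* Let $D_1^*,D_2^*$ be as defined in the context and $c_i=\frac12\log_2\!\big[\frac{\pi e}{6}\big(\frac{D_i^*}{D_i}+1\big)\big]$, $i=1,2$. For any $(R_1^*,R_2^* )\in\mathcal R^*(D_1^*,D_2^* )$ and any $(R_1,R_2)\in\mathcal R(D_1,D_2)$ with $R_1\in\overline{\mathcal R}_1(D_1,D_2)$ and $R_1+R_2=H(Y_1,Y_2\mid Z_1,Z_2)$, $$R_1+R_2\le R_1^*+R_2^*+c_1+c_2.$$ Moreover, for every $(R_1^*,R_2^* )\in\mathcal R^*(D_1^*,D_2^* )$ with $R_1^*\in\overline{\mathcal R}_1(D_1,D_2)$ there exists $(R_1,R_2)\in\mathcal R(D_1,D_2)$ with $R_1=R_1^*$ and $R_2\le R_2^*+c_1+c_2$.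
   Context: Logarithms base 2. $(X_1,X_2)$ is a memoryless pair of real random variables with joint density supported in $[-A,A]^2$, with $\mathbb E X_1=\mathbb E X_2=0$; $\sigma_i^2=\mathbb E[X_i^2]$, $\rho=\mathbb E[X_1X_2]$; $D_1,D_2>0$. For distortion levels $(d_1,d_2)$, $\mathcal R^*(d_1,d_2)$ is the set of pairs $(R_1^*,R_2^* )$ such that for every $\delta>0$ and all large $n$ there exist encoders $f_i:[-A,A]^n\to\{1,\dots,M_i\}$ and a decoder $g$ producing $(\hat{\mathbf X}_1,\hat{\mathbf X}_2)$ from $(f_1(\mathbf X_1),f_2(\mathbf X_2))$ with $\frac1n\mathbb E\|\mathbf X_i-\hat{\mathbf X}_i\|^2\le d_i+\delta$ and $\frac1n\log M_i\le R_i^*+\delta$. For $i=1,2$: $\mathcal Q_i$ maps $x$ to the nearest point of $2\sqrt{3D_i}\mathbb Z$, $Z_1,Z_2$ are independent of each other and of the source with $Z_i$ uniform on $[-\sqrt{3D_i},\sqrt{3D_i}]$, $Y_i=\mathcal Q_i(X_i+Z_i)$. $\mathcal R(D_1,D_2)$ is the set of $(R_1,R_2)$ with $R_1\ge H(Y_1|Y_2,Z_1,Z_2)$, $R_2\ge H(Y_2|Y_1,Z_1,Z_2)$, $R_1+R_2\ge H(Y_1,Y_2|Z_1,Z_2)$; $\overline{\mathcal R}_1(D_1,D_2)=[H(Y_1|Y_2,Z_1,Z_2),H(Y_1|Z_1)]$. With $|\Lambda|=(\sigma_1^2+D_1)(\sigma_2^2+D_2)-\rho^2$, $D_1^*=D_1\frac{\sigma_1^2(\sigma_2^2+D_2)-\rho^2}{|\Lambda|}$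 and $D_2^*=D_2\frac{\sigma_2^2(\sigma_1^2+D_1)-\rho^2}{|\Lambda|}$; these are the per-letter mean-square errors obtained when the decoder of the dithered scheme (which achieves the rates in $\mathcal R(D_1,D_2)$) outputs the linear MMSE estimate of each $X_i$ from $(Y_1-Z_1,Y_2-Z_2)$. *)

theory Defs
  imports "HOL-Probability.Probability"
begin

definition src :: "(real \<times> real \<Rightarrow> real) \<Rightarrow> (real \<times> real) measure" where
  "src p = density lborel (\<lambda>x. ennreal (p x))"

definition sig1sq :: "(real \<times> real \<Rightarrow> real) \<Rightarrow> real" where
  "sig1sq p = (\<integral>x. (fst x)^2 * p x \<partial>lborel)"
definition sig2sq :: "(real \<times> real \<Rightarrow> real) \<Rightarrow> real" where
  "sig2sq p = (\<integral>x. (snd x)^2 * p x \<partial>lborel)"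
definition rho :: "(real \<times> real \<Rightarrow> real) \<Rightarrow> real" where
  "rho p = (\<integral>x. fst x * snd x * p x \<partial>lborel)"

definition detLambda :: "(real \<times> real \<Rightarrow> real) \<Rightarrow> real \<Rightarrow> real \<Rightarrow> real" where
  "detLambda p D1 D2 = (sig1sq p + D1) * (sig2sq p + D2) - (rho p)^2"

definition Dstar1 :: "(real \<times> real \<Rightarrow> real) \<Rightarrow> real \<Rightarrow> real \<Rightarrow> real" where
  "Dstar1 p D1 D2 = D1 * (sig1sq p * (sig2sq p + D2) - (rho p)^2) / detLambda p D1 D2"
definition Dstar2 :: "(real \<times> real \<Rightarrow> real) \<Rightarrow> real \<Rightarrow> real \<Rightarrow> real" where
  "Dstar2 p D1 D2 = D2 * (sig2sq p * (sig1sq p + D1) - (rho p)^2) / detLambda p D1 D2"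

definition quant :: "real \<Rightarrow> real \<Rightarrow> real" where
  "quant D x = (2 * sqrt (3 * D)) * of_int (round (x / (2 * sqrt (3 * D))))"

definition dent :: "'a measure \<Rightarrow> ('a \<Rightarrow> 'b) \<Rightarrow> real" where
  "dent M U = (\<Sum>\<^sub>\<infinity>u \<in> U ` space M.
      - (measure M {x \<in> space M. U x = u} * log 2 (measure M {x \<in> space M. U x = u})))"

definition dcent :: "'a measure \<Rightarrow> ('a \<Rightarrow> 'b) \<Rightarrow> ('a \<Rightarrow> 'c) \<Rightarrow> real" where
  "dcent M U V = (\<Sum>\<^sub>\<infinity>(u,v) \<in> (\<lambda>x. (U x, V x)) ` space M.
      - (measure M {x \<in> space M. U x = u \<and> V x = v} *
         log 2 (measure M {x \<in> space M. U x = u \<and> V x = v} / measure M {x \<in> space M. V x = v})))"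

definition dith :: "real \<Rightarrow> real \<Rightarrow> (real \<times> real) measure" where
  "dith D1 D2 = uniform_measure lborel
     ({- sqrt (3 * D1) .. sqrt (3 * D1)} \<times> {- sqrt (3 * D2) .. sqrt (3 * D2)})"

text \<open>Conditional entropies given the dither, H(.|Z=z) averaged over the dither law
  (Z is independent of the source, so given Z=z, Yi = quant Di (Xi + zi) is a function of X).\<close>
definition H_Y1Y2_Z :: "(real \<times> real) measure \<Rightarrow> real \<Rightarrow> real \<Rightarrow> real" where
  "H_Y1Y2_Z P D1 D2 = (\<integral>z. dent P (\<lambda>x. (quant D1 (fst x + fst z), quant D2 (snd x + snd z)))
       \<partial>dith D1 D2)"
definition H_Y1_Y2Z :: "(real \<times> real) measure \<Rightarrow> real \<Rightarrow> real \<Rightarrow> real" where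
  "H_Y1_Y2Z P D1 D2 = (\<integral>z. dcent P (\<lambda>x. quant D1 (fst x + fst z)) (\<lambda>x. quant D2 (snd x + snd z))
       \<partial>dith D1 D2)"
definition H_Y2_Y1Z :: "(real \<times> real) measure \<Rightarrow> real \<Rightarrow> real \<Rightarrow> real" where
  "H_Y2_Y1Z P D1 D2 = (\<integral>z. dcent P (\<lambda>x. quant D2 (snd x + snd z)) (\<lambda>x. quant D1 (fst x + fst z))
       \<partial>dith D1 D2)"
definition H_Y1_Z1 :: "(real \<times> real) measure \<Rightarrow> real \<Rightarrow> real" where
  "H_Y1_Z1 P D1 = (\<integral>z1. dent P (\<lambda>x. quant D1 (fst x + z1))
       \<partial>uniform_measure lborel {- sqrt (3 * D1) .. sqrt (3 * D1)})"

definition rate_region :: "(real \<times> real) measure \<Rightarrow> real \<Rightarrow> real \<Rightarrow> (real \<times> real) set" where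
  "rate_region P D1 D2 = {(R1, R2). H_Y1_Y2Z P D1 D2 \<le> R1 \<and> H_Y2_Y1Z P D1 D2 \<le> R2 \<and>
       H_Y1Y2_Z P D1 D2 \<le> R1 + R2}"

definition rate_interval1 :: "(real \<times> real) measure \<Rightarrow> real \<Rightarrow> real \<Rightarrow> real set" where
  "rate_interval1 P D1 D2 = {H_Y1_Y2Z P D1 D2 .. H_Y1_Z1 P D1}"

text \<open>Operational (distributed, memoryless) rate-distortion achievability.
  A length-n source block is an element of PiM {..<n} (\<lambda>_. P); its i-th components
  are the sequences (\<lambda>k. fst (x k)) and (\<lambda>k. snd (x k)).\<close>
definition achievable :: "(real \<times> real) measure \<Rightarrow> real \<Rightarrow> real \<Rightarrow> real \<Rightarrow> real \<Rightarrow> bool" where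
  "achievable P d1 d2 R1 R2 \<longleftrightarrow>
    (\<forall>\<delta>>0. \<exists>N. \<forall>n\<ge>N. \<exists>(M1::nat) (M2::nat) (f1::(nat \<Rightarrow> real) \<Rightarrow> nat) (f2::(nat \<Rightarrow> real) \<Rightarrow> nat)
        (g :: nat \<Rightarrow> nat \<Rightarrow> (nat \<Rightarrow> real) \<times> (nat \<Rightarrow> real)).
      1 \<le> M1 \<and> 1 \<le> M2 \<and> (\<forall>u. f1 u \<in> {1..M1}) \<and> (\<forall>u. f2 u \<in> {1..M2}) \<and>
      (\<lambda>x. f1 (\<lambda>k. fst (x k))) \<in> PiM {..<n} (\<lambda>_. P) \<rightarrow>\<^sub>M count_space UNIV \<and>
      (\<lambda>x. f2 (\<lambda>k. snd (x k))) \<in> PiM {..<n} (\<lambda>_. P) \<rightarrow>\<^sub>M count_space UNIV \<and>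
      (1 / real n) * (\<integral>x. (\<Sum>k<n. (fst (x k) -
          fst (g (f1 (\<lambda>k. fst (x k))) (f2 (\<lambda>k. snd (x k)))) k)^2) \<partial>PiM {..<n} (\<lambda>_. P)) \<le> d1 + \<delta> \<and>
      (1 / real n) * (\<integral>x. (\<Sum>k<n. (snd (x k) -
          snd (g (f1 (\<lambda>k. fst (x k))) (f2 (\<lambda>k. snd (x k)))) k)^2) \<partial>PiM {..<n} (\<lambda>_. P)) \<le> d2 + \<delta> \<and>
      log 2 (real M1) / real n \<le> R1 + \<delta> \<and> log 2 (real M2) / real n \<le> R2 + \<delta>)"

definition cconst :: "real \<Rightarrow> real \<Rightarrow> real" where
  "cconst Ds D = 1/2 * log 2 (pi * exp 1 / 6 * (Ds / D + 1))"

end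

theory Submission
  imports Defs
begin

text \<open>
  Write \<open>q\<close> for the density of \<open>X + N\<close>, where \<open>N\<close> is uniform on the dither cell \<open>B\<close>. Averaging
  over the dither tiles the plane, so \<open>H(Y1,Y2|Z) = E [- log (|B| q(X + N))] = E [\<ell>(X)]\<close> with
  \<open>\<ell>(x) = E [- log (|B| q(x + N))]\<close>. Jensen's inequality over \<open>N\<close> and a Gaussian integral bound
  \<open>E [exp (\<ell>(X) - ((X1 - a1)\<^sup>2 + D1) / (2 V1) - ((X2 - a2)\<^sup>2 + D2) / (2 V2))]\<close> by \<open>2 \<pi> (V1 V2)\<^bsup>1/2\<^esup> / |B|\<close>
  for every reproduction point \<open>a\<close>. For a block code this bound tensorizes; summing it over the
  \<open>M1 M2\<close> reproduction words and applying Jensen once more bounds \<open>n E [\<ell>(X)]\<close> by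
  \<open>log (M1 M2)\<close> plus the distortion terms. With \<open>Vi = Di* + \<delta> + Di\<close> and \<open>\<delta> \<rightarrow> 0\<close> this is the sum-rate
  bound. The second claim takes \<open>R2 = H(Y1,Y2|Z) - R1\<close> and uses the chain rule for entropy.
\<close>

section \<open>Jensen's inequality with values in the extended nonnegative reals\<close>

text \<open>If \<open>g\<close> is integrable, compare it with its positive part, which
  \<open>ennreal\<close> sees anyway; otherwise the Bochner integral is 0 by convention.\<close>

lemma ennreal_integral_le_nn_integral:
  fixes g :: "'a \<Rightarrow> real"
  shows "ennreal (integral\<^sup>L M g) \<le> (\<integral>\<^sup>+x. ennreal (g x) \<partial>M)"
proof (cases "integrable M g")
  case g: True
  have "integral\<^sup>L M g \<le> (\<integral>x. max 0 (g x) \<partial>M)"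
    using g by (intro integral_mono) auto
  moreover have "ennreal (\<integral>x. max 0 (g x) \<partial>M) = (\<integral>\<^sup>+x. ennreal (max 0 (g x)) \<partial>M)"
    using g by (intro nn_integral_eq_integral[symmetric]) auto
  moreover have "\<dots> = (\<integral>\<^sup>+x. ennreal (g x) \<partial>M)"
    by (intro nn_integral_cong) (auto simp: max_def ennreal_neg)
  ultimately show ?thesis by (metis ennreal_leI)
qed (simp add: not_integrable_integral_eq)

text \<open>Jensen via the tangent line of \<open>exp\<close> at the mean \<open>m\<close>. With the
  right side in \<open>ennreal\<close>, integrability of \<open>exp (h x)\<close> is never at
  issue.\<close>

lemma (in prob_space) exp_expectation_le:
  fixes h :: "'a \<Rightarrow> real"
  assumes h: "integrable M h"
  shows "ennreal (exp (expectation h)) \<le> (\<integral>\<^sup>+x. ennreal (exp (h x)) \<partial>M)"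
proof -
  define m where "m = expectation h"
  define g where "g = (\<lambda>x. exp m * (1 + (h x - m)))"
  have g: "integrable M g" unfolding g_def using h by auto
  have "expectation g = exp m" unfolding g_def using h by (simp add: m_def prob_space)
  moreover have "g x \<le> exp (h x)" for x
    using mult_left_mono[OF exp_ge_add_one_self[of "h x - m"], of "exp m"]
    by (simp add: g_def exp_diff)
  then have "(\<integral>\<^sup>+x. ennreal (g x) \<partial>M) \<le> (\<integral>\<^sup>+x. ennreal (exp (h x)) \<partial>M)"
    by (intro nn_integral_mono) (auto intro: ennreal_leI)
  moreover note ennreal_integral_le_nn_integral[of M g]
  ultimately show ?thesis by (simp add: m_def)
qed

subsection \<open>Entropies of finitely supported variables\<close>

text \<open>A measurable event here is null, and a non-measurable one has measure 0 by convention.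
  The extra conjunct \<open>Q\<close> is there for joint events.\<close>

lemma measure_eq_0_of_AE_mem:
  assumes "AE x in M. U x \<in> F" "u \<notin> F"
  shows "measure M {x \<in> space M. U x = u \<and> Q x} = 0"
proof -
  have "AE x in M. x \<notin> {x \<in> space M. U x = u \<and> Q x}"
    using assms(1) by eventually_elim (use assms(2) in auto)
  then show ?thesis
    using AE_iff_null_sets[of "{x \<in> space M. U x = u \<and> Q x}" M] measure_eq_0_null_sets
      measure_notin_sets[of "{x \<in> space M. U x = u \<and> Q x}" M] by blast
qed

text \<open>Values outside \<open>F\<close> have measure 0, and points of \<open>F\<close> outside
  the image give the empty event, so both kinds contribute 0 and the infinite sum may run over
  \<open>F\<close> instead.\<close>

lemma dent_finite:
  assumes "finite F" "AE x in M. U x \<in> F"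
  shows "dent M U = (\<Sum>u\<in>F. - (measure M {x \<in> space M. U x = u} *
    log 2 (measure M {x \<in> space M. U x = u})))"
proof -
  have Z: "measure M {x \<in> space M. U x = u} = 0" if "u \<notin> F" for u
    using measure_eq_0_of_AE_mem[OF assms(2) that, of "\<lambda>_. True"] by simp
  have E: "measure M {x \<in> space M. U x = u} = 0" if "u \<notin> U ` space M" for u
  proof -
    have "{x \<in> space M. U x = u} = {}" using that by auto
    then show ?thesis by (simp only: measure_empty)
  qed
  have "dent M U = (\<Sum>\<^sub>\<infinity>u\<in>F. - (measure M {x \<in> space M. U x = u} *
    log 2 (measure M {x \<in> space M. U x = u})))"
    unfolding dent_def by (rule infsum_cong_neutral) (use Z E in auto)
  then show ?thesis using assms(1) by simp
qed

lemma dcent_finite: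
  assumes "finite F" "finite G" "AE x in M. U x \<in> F" "AE x in M. V x \<in> G"
  shows "dcent M U V = (\<Sum>(u,v)\<in>F \<times> G. - (measure M {x \<in> space M. U x = u \<and> V x = v} *
         log 2 (measure M {x \<in> space M. U x = u \<and> V x = v} / measure M {x \<in> space M. V x = v})))"
proof -
  have Z: "measure M {x \<in> space M. U x = u \<and> V x = v} = 0" if "(u, v) \<notin> F \<times> G" for u v
    using that measure_eq_0_of_AE_mem[OF assms(3), of u "\<lambda>x. V x = v"]
      measure_eq_0_of_AE_mem[OF assms(4), of v "\<lambda>x. U x = u"]
    by (auto simp: conj_commute)
  have E: "measure M {x \<in> space M. U x = u \<and> V x = v} = 0"
    if "(u, v) \<notin> (\<lambda>x. (U x, V x)) ` space M" for u v
  proof -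
    have "{x \<in> space M. U x = u \<and> V x = v} = {}" using that by auto
    then show ?thesis by (simp only: measure_empty)
  qed
  have "dcent M U V = (\<Sum>\<^sub>\<infinity>(u,v)\<in>F \<times> G. - (measure M {x \<in> space M. U x = u \<and> V x = v} *
         log 2 (measure M {x \<in> space M. U x = u \<and> V x = v} / measure M {x \<in> space M. V x = v})))"
    unfolding dcent_def
  proof (rule infsum_cong_neutral, goal_cases)
    case (1 q) then show ?case by (cases q) (use E in force)
  next
    case (2 q) then show ?case by (cases q) (use Z in force)
  qed simp
  then show ?thesis using assms(1,2) by simp
qed

text \<open>Split each logarithm of a joint probability into conditional plus marginal; summing the
  joint law over \<open>F\<close> recovers the marginal of \<open>V\<close>.\<close>

lemma (in prob_space) dent_chain_rule:
  assumes fin: "finite F" "finite G" and U: "AE x in M. U x \<in> F" and V: "AE x in M. V x \<in> G"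
    and meas: "\<And>u. {x \<in> space M. U x = u} \<in> events" "\<And>v. {x \<in> space M. V x = v} \<in> events"
  shows "dent M (\<lambda>x. (V x, U x)) = dcent M U V + dent M V"
proof -
  define j where "j u v = prob {x \<in> space M. U x = u \<and> V x = v}" for u v
  define m where "m v = prob {x \<in> space M. V x = v}" for v
  have ev: "{x \<in> space M. U x = u \<and> V x = v} \<in> events" for u v
  proof -
    have "{x \<in> space M. U x = u \<and> V x = v} = {x \<in> space M. U x = u} \<inter> {x \<in> space M. V x = v}" by auto
    then show ?thesis using meas by simp
  qed
  have m: "m v = (\<Sum>u\<in>F. j u v)" for v
  proof -
    have "(\<Sum>u\<in>F. j u v) = prob (\<Union>u\<in>F. {x \<in> space M. U x = u \<and> V x = v})"
      unfolding j_def by (rule finite_measure_finite_Union[symmetric])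
        (auto simp: fin ev disjoint_family_on_def)
    also have "\<dots> = m v"
      unfolding m_def
    proof (rule finite_measure_eq_AE)
      show "AE x in M. (x \<in> (\<Union>u\<in>F. {x \<in> space M. U x = u \<and> V x = v})) = (x \<in> {x \<in> space M. V x = v})"
        using U by eventually_elim auto
    qed (use fin ev meas in auto)
    finally show ?thesis by simp
  qed
  have le: "j u v \<le> m v" for u v
    unfolding j_def m_def by (rule finite_measure_mono) (use meas in auto)
  have nonneg: "0 \<le> j u v" for u v by (simp add: j_def)
  \<comment> \<open>When \<open>j u v\<close> vanishes both sides are 0; otherwise
    \<open>m v\<close> is positive too and the quotient rule for \<open>log\<close> applies.\<close>
  have split: "- (j u v * log 2 (j u v)) = - (j u v * log 2 (j u v / m v)) - j u v * log 2 (m v)" for u v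
  proof (cases "j u v = 0")
    case False
    then have "0 < j u v" "0 < m v" using nonneg[of u v] le[of u v] by auto
    then show ?thesis by (simp add: log_divide algebra_simps)
  qed simp
  have UV: "AE x in M. (V x, U x) \<in> G \<times> F" using U V by eventually_elim auto
  have "dent M (\<lambda>x. (V x, U x)) = (\<Sum>(v,u)\<in>G \<times> F. - (j u v * log 2 (j u v)))"
    by (subst dent_finite[OF _ UV]) (auto simp: fin j_def conj_commute intro!: sum.cong)
  also have "\<dots> = (\<Sum>v\<in>G. \<Sum>u\<in>F. - (j u v * log 2 (j u v / m v)) - j u v * log 2 (m v))"
    by (simp only: sum.cartesian_product[symmetric] split[symmetric])
  also have "\<dots> = (\<Sum>v\<in>G. \<Sum>u\<in>F. - (j u v * log 2 (j u v / m v))) - (\<Sum>v\<in>G. m v * log 2 (m v))"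
    by (simp only: sum_subtractf sum_distrib_right[symmetric] m[symmetric])
  also have "(\<Sum>v\<in>G. \<Sum>u\<in>F. - (j u v * log 2 (j u v / m v))) = dcent M U V"
    by (subst dcent_finite[OF fin U V])
      (simp only: j_def m_def sum.cartesian_product[symmetric] sum.swap[of _ G F])
  also have "(\<Sum>v\<in>G. m v * log 2 (m v)) = - dent M V"
    by (subst dent_finite[OF fin(2) V]) (simp add: m_def sum_negf)
  finally show ?thesis by simp
qed

subsection \<open>Lattice quantizer and dither\<close>

text \<open>\<open>round\<close> is the floor of \<open>x + 1/2\<close>, so ties go up and the
  offset \<open>y - x\<close> lies in an interval open on the left and closed on the right.\<close>

lemma quant_eq_iff:
  assumes "0 < D"
  shows "quant D x = y \<longleftrightarrow> y \<in> range (\<lambda>k::int. 2 * sqrt (3 * D) * of_int k) \<and>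
    y - x \<in> {- sqrt (3 * D) <.. sqrt (3 * D)}"
proof -
  define s where "s = sqrt (3 * D)"
  have s: "0 < s" using assms by (simp add: s_def)
  have r: "round (x / (2 * s)) = k \<longleftrightarrow> 2 * s * of_int k - x \<in> {-s <.. s}" for k :: int
    unfolding round_def floor_eq_iff using s by (auto simp: field_simps)
  show ?thesis unfolding quant_def s_def[symmetric]
    using r s by auto
qed

text \<open>Truncating at radius \<open>C\<close> makes the lattice finite, so that entropies become
  finite sums.\<close>

definition lattice_pts :: "real \<Rightarrow> real \<Rightarrow> real set" where
  "lattice_pts D C = {y \<in> range (\<lambda>k::int. 2 * sqrt (3 * D) * of_int k). \<bar>y\<bar> \<le> C}"

lemma finite_lattice_pts:
  assumes "0 < D"
  shows "finite (lattice_pts D C)"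
proof -
  define s where "s = sqrt (3 * D)"
  have s: "0 < s" using assms by (simp add: s_def)
  let ?m = "\<lceil>C / (2 * s)\<rceil>"
  have "lattice_pts D C \<subseteq> (\<lambda>k::int. 2 * s * of_int k) ` {- ?m .. ?m}"
  proof
    fix y assume "y \<in> lattice_pts D C"
    then obtain k :: int where k: "y = 2 * s * of_int k" "\<bar>y\<bar> \<le> C"
      by (auto simp: lattice_pts_def s_def)
    then have "\<bar>of_int k\<bar> \<le> C / (2 * s)" using s by (simp add: abs_mult field_simps)
    then have "\<bar>k\<bar> \<le> ?m" by (metis ceiling_mono ceiling_of_int of_int_abs)
    then have "k \<in> {- ?m .. ?m}" unfolding abs_le_iff by simp
    then show "y \<in> (\<lambda>k::int. 2 * s * of_int k) ` {- ?m .. ?m}" using k(1) by blast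
  qed
  then show ?thesis by (rule finite_subset) simp
qed

lemma quant_in_lattice_pts:
  assumes "0 < D" "\<bar>x\<bar> + sqrt (3 * D) \<le> C"
  shows "quant D x \<in> lattice_pts D C"
  using quant_eq_iff[OF assms(1), of x "quant D x"] assms(2)
  by (auto simp: lattice_pts_def)

lemma measurable_quant [measurable]: "quant D \<in> borel_measurable borel"
  unfolding quant_def[abs_def] round_def by measurable

text \<open>Both points are the quantizer's output at \<open>w\<close>.\<close>

lemma box_separated_lattice:
  assumes "0 < D" "y \<in> lattice_pts D A" "y' \<in> lattice_pts D A"
    "y - w \<in> {- sqrt (3 * D) <.. sqrt (3 * D)}" "y' - w \<in> {- sqrt (3 * D) <.. sqrt (3 * D)}"
  shows "y = y'"
proof -
  have "quant D w = y" "quant D w = y'"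
    using assms(2-) by (simp_all only: quant_eq_iff[OF assms(1)] lattice_pts_def mem_Collect_eq)
  then show ?thesis by simp
qed

abbreviation dbox :: "real \<Rightarrow> real \<Rightarrow> (real \<times> real) set" where
  "dbox D1 D2 \<equiv> {- sqrt (3 * D1) .. sqrt (3 * D1)} \<times> {- sqrt (3 * D2) .. sqrt (3 * D2)}"

text \<open>The half-open version of \<open>dbox\<close>: its lattice translates are disjoint, while
  it differs from the support of the dither only by a null set.\<close>

definition cell :: "real \<Rightarrow> real \<Rightarrow> (real \<times> real) set" where
  "cell D1 D2 = {- sqrt (3 * D1) <.. sqrt (3 * D1)} \<times> {- sqrt (3 * D2) <.. sqrt (3 * D2)}"

lemma cell_sets [measurable]: "cell D1 D2 \<in> sets borel"
  unfolding cell_def by (subst borel_prod[symmetric]) measurable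

lemma dbox_sets [measurable]: "dbox D1 D2 \<in> sets borel"
  by (subst borel_prod[symmetric]) measurable

lemma emeasure_lborel_Times:
  fixes S T :: "real set"
  assumes [measurable]: "S \<in> sets borel" "T \<in> sets borel"
  shows "emeasure lborel (S \<times> T) = emeasure lborel S * emeasure lborel T"
  by (subst lborel_prod[symmetric], subst lborel.emeasure_pair_measure_Times) auto

lemma emeasure_dbox:
  assumes "0 < D1" "0 < D2"
  shows "emeasure lborel (dbox D1 D2) = ennreal (12 * sqrt (D1 * D2))"
proof -
  have "2 * sqrt (3 * D1) * (2 * sqrt (3 * D2)) = 12 * sqrt (D1 * D2)"
    by (simp add: real_sqrt_mult)
  then show ?thesis using assms
    by (subst emeasure_lborel_Times) (auto simp: ennreal_mult[symmetric])
qed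

text \<open>The two indicators can differ only on the left and bottom edge lines, which have area
  0.\<close>

lemma indicator_cell_AE:
  "AE z in lborel. (indicator (dbox D1 D2) z :: ennreal) = indicator (cell D1 D2) z"
proof -
  have "({c} \<times> UNIV :: (real \<times> real) set) \<in> null_sets lborel"
    "(UNIV \<times> {c} :: (real \<times> real) set) \<in> null_sets lborel" for c
    using emeasure_lborel_Times[of "{c}" UNIV] emeasure_lborel_Times[of UNIV "{c}"]
    by (auto simp: borel_Times)
  from AE_not_in[OF this(1)[of "- sqrt (3 * D1)"]] AE_not_in[OF this(2)[of "- sqrt (3 * D2)"]]
  show ?thesis
    by eventually_elim (auto simp: cell_def indicator_def)
qed

lemma dith_sets [measurable_cong, simp]: "sets (dith D1 D2) = sets borel"
  by (simp add: dith_def)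

lemma dith_space [simp]: "space (dith D1 D2) = UNIV"
  by (simp add: dith_def)

lemma measurable_dith_fst_snd [measurable]:
  "fst \<in> borel_measurable (dith D1 D2)" "snd \<in> borel_measurable (dith D1 D2)"
  by (simp_all add: measurable_cong_sets[OF dith_sets refl] borel_prod[symmetric])

lemma prob_space_dith: "0 < D1 \<Longrightarrow> 0 < D2 \<Longrightarrow> prob_space (dith D1 D2)"
  unfolding dith_def by (rule prob_space_uniform_measure) (auto simp: emeasure_dbox)

lemma AE_dith:
  assumes "0 < D1" "0 < D2"
  shows "AE z in dith D1 D2. \<bar>fst z\<bar> \<le> sqrt (3 * D1) \<and> \<bar>snd z\<bar> \<le> sqrt (3 * D2)"
  unfolding dith_def using assms
  by (intro AE_uniform_measureI) (auto simp: abs_le_iff)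

lemma nn_integral_dith:
  assumes [measurable]: "f \<in> borel_measurable borel" and "0 < D1" "0 < D2"
  shows "(\<integral>\<^sup>+z. f z \<partial>dith D1 D2) =
    (\<integral>\<^sup>+z. f z * indicator (cell D1 D2) z \<partial>lborel) / ennreal (12 * sqrt (D1 * D2))"
proof -
  have "(\<integral>\<^sup>+z. f z \<partial>dith D1 D2) =
      (\<integral>\<^sup>+z. f z * indicator (dbox D1 D2) z \<partial>lborel) / emeasure lborel (dbox D1 D2)"
    unfolding dith_def by (rule nn_integral_uniform_measure) auto
  moreover have "(\<integral>\<^sup>+z. f z * indicator (dbox D1 D2) z \<partial>lborel) =
      (\<integral>\<^sup>+z. f z * indicator (cell D1 D2) z \<partial>lborel)"
    using indicator_cell_AE[of D1 D2] by (intro nn_integral_cong_AE) (auto)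
  ultimately show ?thesis using assms by (simp add: emeasure_dbox)
qed

lemma ennreal_cancel_right:
  fixes a :: ennreal and b c :: real
  assumes "0 < b" "0 < c"
  shows "a * ennreal c / (ennreal b * ennreal c) = a / ennreal b"
  using assms
  by (cases a) (auto simp: ennreal_mult[symmetric] divide_ennreal ennreal_top_mult ennreal_top_divide)

text \<open>The length of the second side cancels in the quotient of areas. This carries
  one-dimensional facts over to the planar dither.\<close>

lemma distr_dith_fst:
  assumes "0 < D1" "0 < D2"
  shows "distr (dith D1 D2) borel fst = uniform_measure lborel {- sqrt (3 * D1) .. sqrt (3 * D1)}"
proof (rule measure_eqI)
  fix S assume "S \<in> sets (distr (dith D1 D2) borel fst)"
  then have S [measurable]: "S \<in> sets borel" by simp
  have "emeasure (distr (dith D1 D2) borel fst) S = emeasure (dith D1 D2) (S \<times> UNIV)"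
    by (subst emeasure_distr) (auto simp: vimage_fst)
  also have "\<dots> = emeasure lborel (dbox D1 D2 \<inter> S \<times> UNIV) / emeasure lborel (dbox D1 D2)"
    unfolding dith_def by (rule emeasure_uniform_measure) (auto simp: borel_Times)
  also have "dbox D1 D2 \<inter> S \<times> UNIV = ({- sqrt (3 * D1) .. sqrt (3 * D1)} \<inter> S) \<times> {- sqrt (3 * D2) .. sqrt (3 * D2)}"
    by auto
  also have "emeasure lborel \<dots> / emeasure lborel (dbox D1 D2) =
     emeasure lborel ({- sqrt (3 * D1) .. sqrt (3 * D1)} \<inter> S) / emeasure lborel {- sqrt (3 * D1) .. sqrt (3 * D1)}"
    using assms by (subst (1 2) emeasure_lborel_Times) (auto intro!: ennreal_cancel_right)
  finally show "emeasure (distr (dith D1 D2) borel fst) S = emeasure (uniform_measure lborel {- sqrt (3 * D1) .. sqrt (3 * D1)}) S"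
    by (subst emeasure_uniform_measure) auto
qed simp

lemma distr_dith_snd:
  assumes "0 < D1" "0 < D2"
  shows "distr (dith D1 D2) borel snd = uniform_measure lborel {- sqrt (3 * D2) .. sqrt (3 * D2)}"
proof (rule measure_eqI)
  fix S assume "S \<in> sets (distr (dith D1 D2) borel snd)"
  then have S [measurable]: "S \<in> sets borel" by simp
  have "emeasure (distr (dith D1 D2) borel snd) S = emeasure (dith D1 D2) (UNIV \<times> S)"
    by (subst emeasure_distr) (auto simp: vimage_snd)
  also have "\<dots> = emeasure lborel (dbox D1 D2 \<inter> UNIV \<times> S) / emeasure lborel (dbox D1 D2)"
    unfolding dith_def by (rule emeasure_uniform_measure) (auto simp: borel_Times)
  also have "dbox D1 D2 \<inter> UNIV \<times> S = {- sqrt (3 * D1) .. sqrt (3 * D1)} \<times> ({- sqrt (3 * D2) .. sqrt (3 * D2)} \<inter> S)"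
    by auto
  also have "emeasure lborel \<dots> / emeasure lborel (dbox D1 D2) =
     emeasure lborel ({- sqrt (3 * D2) .. sqrt (3 * D2)} \<inter> S) / emeasure lborel {- sqrt (3 * D2) .. sqrt (3 * D2)}"
    using assms by (subst (1 2) emeasure_lborel_Times)
      (auto simp: mult.commute[of "ennreal (2 * sqrt (3 * D1))"] intro!: ennreal_cancel_right)
  finally show "emeasure (distr (dith D1 D2) borel snd) S = emeasure (uniform_measure lborel {- sqrt (3 * D2) .. sqrt (3 * D2)}) S"
    by (subst emeasure_uniform_measure) auto
qed simp

section \<open>Second moments of the dither\<close>

text \<open>A uniform variable on \<open>{-s..s}\<close> has mean 0 and variance
  \<open>s^2 / 3\<close>, which is \<open>D\<close> for \<open>s = sqrt (3 * D)\<close>.\<close>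

lemma uniform_second_moment:
  fixes c D :: real
  assumes D: "0 < D"
  defines "U \<equiv> uniform_measure lborel {- sqrt (3 * D) .. sqrt (3 * D)}"
  shows "integrable U (\<lambda>z. (c + z)\<^sup>2)" "(\<integral>z. (c + z)\<^sup>2 \<partial>U) = c\<^sup>2 + D"
proof -
  define s where "s = sqrt (3 * D)"
  have s: "0 < s" "s\<^sup>2 = 3 * D" using D by (auto simp: s_def)
  have U: "U = density lborel (\<lambda>z. ennreal (indicator {-s..s} z / (2 * s)))"
    unfolding U_def uniform_measure_def s_def[symmetric] using s
    by (intro density_cong AE_I2) (auto simp: indicator_def divide_ennreal[symmetric])
  have P: "integrable U (\<lambda>z. z ^ k)" "(\<integral>z. z ^ k \<partial>U) = (s ^ Suc k - (- s) ^ Suc k) / Suc k / (2 * s)" for k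
  proof -
    have I: "integrable lborel (\<lambda>z. z ^ k * indicator {-s..s} z)"
      by (rule borel_integrable_atLeastAtMost) auto
    then have "integrable lborel (\<lambda>z. z ^ k * indicator {-s..s} z / (2 * s))"
      by (rule integrable_divide)
    then show "integrable U (\<lambda>z. z ^ k)" unfolding U using s
      by (subst integrable_density) (auto simp: mult_ac)
    have "(\<integral>z. z ^ k \<partial>U) = (\<integral>z. z ^ k * indicator {-s..s} z / (2 * s) \<partial>lborel)"
      unfolding U using s by (subst integral_density) (auto simp: mult_ac)
    also have "\<dots> = (s ^ Suc k - (- s) ^ Suc k) / Suc k / (2 * s)"
      using s integral_power[of "-s" s k] by (simp only: integral_divide_zero)
    finally show "(\<integral>z. z ^ k \<partial>U) = (s ^ Suc k - (- s) ^ Suc k) / Suc k / (2 * s)" .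
  qed
  \<comment> \<open>Written in powers of \<open>z\<close>, including \<open>z ^ 0\<close>, so that
    the moment formula \<open>P\<close> covers every summand.\<close>
  have E: "(c + z)\<^sup>2 = c\<^sup>2 * z ^ 0 + 2 * c * z ^ 1 + z ^ 2" for z
    by (simp add: power2_eq_square algebra_simps)
  show "integrable U (\<lambda>z. (c + z)\<^sup>2)" unfolding E
    by (intro Bochner_Integration.integrable_add integrable_mult_right P(1))
  have "(\<integral>z. (c + z)\<^sup>2 \<partial>U) = c\<^sup>2 * (\<integral>z. z ^ 0 \<partial>U) + 2 * c * (\<integral>z. z ^ 1 \<partial>U) + (\<integral>z. z ^ 2 \<partial>U)"
    unfolding E
    by (subst Bochner_Integration.integral_add Bochner_Integration.integral_mult_right_zero;
        (intro Bochner_Integration.integrable_add integrable_mult_right P(1))?)+ simp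
  also have "\<dots> = c\<^sup>2 + D" unfolding P(2) using s by (simp add: eval_nat_numeral field_simps)
  finally show "(\<integral>z. (c + z)\<^sup>2 \<partial>U) = c\<^sup>2 + D" .
qed

lemma dith_second_moments:
  fixes c D1 D2 :: real
  assumes "0 < D1" "0 < D2"
  shows "integrable (dith D1 D2) (\<lambda>z. (c + fst z)\<^sup>2)" "(\<integral>z. (c + fst z)\<^sup>2 \<partial>dith D1 D2) = c\<^sup>2 + D1"
    "integrable (dith D1 D2) (\<lambda>z. (c + snd z)\<^sup>2)" "(\<integral>z. (c + snd z)\<^sup>2 \<partial>dith D1 D2) = c\<^sup>2 + D2"
proof -
  show "integrable (dith D1 D2) (\<lambda>z. (c + fst z)\<^sup>2)"
    using uniform_second_moment(1)[of D1 c] assms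
    by (simp add: distr_dith_fst[OF assms, symmetric] integrable_distr_eq)
  show "integrable (dith D1 D2) (\<lambda>z. (c + snd z)\<^sup>2)"
    using uniform_second_moment(1)[of D2 c] assms
    by (simp add: distr_dith_snd[OF assms, symmetric] integrable_distr_eq)
  show "(\<integral>z. (c + fst z)\<^sup>2 \<partial>dith D1 D2) = c\<^sup>2 + D1"
    using uniform_second_moment(2)[of D1 c] assms
    by (simp add: distr_dith_fst[OF assms, symmetric] integral_distr)
  show "(\<integral>z. (c + snd z)\<^sup>2 \<partial>dith D1 D2) = c\<^sup>2 + D2"
    using uniform_second_moment(2)[of D2 c] assms
    by (simp add: distr_dith_snd[OF assms, symmetric] integral_distr)
qed

section \<open>Gaussian integrals and changes of variable in the plane\<close>

lemma nn_integral_gaussian: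
  fixes a V :: real
  assumes V: "0 < V"
  shows "(\<integral>\<^sup>+w. ennreal (exp (- ((w - a)\<^sup>2 / (2 * V)))) \<partial>lborel) = ennreal (sqrt (2 * pi * V))"
proof -
  have "ennreal (exp (- ((w - a)\<^sup>2 / (2 * V)))) =
      ennreal (sqrt (2 * pi * V)) * ennreal (normal_density a (sqrt V) w)" for w
    using V by (subst ennreal_mult[symmetric]) (auto simp: normal_density_def)
  then show ?thesis using V
    by (simp add: nn_integral_cmult nn_integral_eq_integral)
qed

lemma nn_integral_gaussian2:
  fixes a :: "real \<times> real"
  assumes V: "0 < V1" "0 < V2"
  shows "(\<integral>\<^sup>+w. ennreal (exp (- ((fst w - fst a)\<^sup>2 / (2 * V1)) - (snd w - snd a)\<^sup>2 / (2 * V2))) \<partial>lborel) =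
    ennreal (2 * pi * sqrt (V1 * V2))"
proof -
  have E: "ennreal (exp (- ((u - fst a)\<^sup>2 / (2 * V1)) - (v - snd a)\<^sup>2 / (2 * V2))) =
     ennreal (exp (- ((u - fst a)\<^sup>2 / (2 * V1)))) * ennreal (exp (- ((v - snd a)\<^sup>2 / (2 * V2))))" for u v
    by (simp add: ennreal_mult[symmetric] exp_add[symmetric])
  have S: "sqrt (2 * pi * V1) * sqrt (2 * pi * V2) = 2 * pi * sqrt (V1 * V2)"
  proof -
    have "sqrt (2 * pi * V1) * sqrt (2 * pi * V2) = sqrt ((2 * pi)\<^sup>2 * (V1 * V2))"
      by (simp add: real_sqrt_mult[symmetric] power2_eq_square mult_ac)
    also have "\<dots> = 2 * pi * sqrt (V1 * V2)" by (simp add: real_sqrt_mult)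
    finally show ?thesis .
  qed
  have "(\<integral>\<^sup>+w. ennreal (exp (- ((fst w - fst a)\<^sup>2 / (2 * V1)) - (snd w - snd a)\<^sup>2 / (2 * V2))) \<partial>lborel) =
     (\<integral>\<^sup>+u. \<integral>\<^sup>+v. ennreal (exp (- ((u - fst a)\<^sup>2 / (2 * V1)) - (v - snd a)\<^sup>2 / (2 * V2))) \<partial>lborel \<partial>lborel)"
    by (subst lborel_prod[symmetric], subst lborel.nn_integral_fst[symmetric]) (auto simp: borel_prod)
  also have "\<dots> = ennreal (sqrt (2 * pi * V1)) * ennreal (sqrt (2 * pi * V2))"
    unfolding E by (simp add: nn_integral_cmult nn_integral_multc nn_integral_gaussian V)
  finally show ?thesis using V S by (simp add: ennreal_mult[symmetric])
qed

lemma nn_integral_lborel_shift: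
  fixes f :: "real \<times> real \<Rightarrow> ennreal" and x :: "real \<times> real"
  assumes [measurable]: "f \<in> borel_measurable borel"
  shows "(\<integral>\<^sup>+z. f (x + z) \<partial>lborel) = (\<integral>\<^sup>+w. f w \<partial>lborel)"
  by (subst lborel_distr_plus[symmetric, of x], subst nn_integral_distr) auto

lemma nn_integral_lborel_reflect:
  fixes f :: "real \<times> real \<Rightarrow> ennreal" and y :: "real \<times> real"
  assumes [measurable]: "f \<in> borel_measurable borel"
  shows "(\<integral>\<^sup>+z. f (y - z) \<partial>lborel) = (\<integral>\<^sup>+w. f w \<partial>lborel)"
proof -
  have "lborel = distr lborel borel (\<lambda>z. y - z)"
    using lborel_affine[of "-1" y] by (simp add: density_1 one_ennreal_def[symmetric])
  then have "(\<integral>\<^sup>+w. f w \<partial>lborel) = (\<integral>\<^sup>+w. f w \<partial>distr lborel borel (\<lambda>z. y - z))" by simp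
  also have "\<dots> = (\<integral>\<^sup>+z. f (y - z) \<partial>lborel)" by (rule nn_integral_distr) auto
  finally show ?thesis by simp
qed

text \<open>The upper bound is \<open>ln s \<le> s - 1\<close> at \<open>s = 1 / t\<close>,
  multiplied by \<open>t\<close>; the case \<open>t = 0\<close> uses
  \<open>0 * ln 0 = 0\<close>.\<close>

lemma neg_mult_ln_bounds:
  fixes t :: real
  assumes "0 \<le> t" "t \<le> 1"
  shows "0 \<le> - (t * ln t)" "- (t * ln t) \<le> 1"
proof -
  show "0 \<le> - (t * ln t)" using assms by (cases "t = 0") (auto intro: mult_nonneg_nonpos)
  show "- (t * ln t) \<le> 1"
  proof (cases "t = 0")
    case False
    then have "0 < t" using assms by simp
    then have "- ln t \<le> 1 / t - 1" using ln_le_minus_one[of "1 / t"] by (simp add: ln_div)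
    then have "t * (- ln t) \<le> t * (1 / t - 1)" using \<open>0 < t\<close> by (intro mult_left_mono) auto
    then show ?thesis using \<open>0 < t\<close> by (simp add: algebra_simps)
  qed simp
qed

subsection \<open>The source convolved with the dither\<close>

locale bounded_source = prob_space P for P :: "(real \<times> real) measure" +
  fixes A D1 D2 :: real
  assumes sets_P [measurable_cong, simp]: "sets P = sets borel"
    and bounded: "AE x in P. \<bar>fst x\<bar> \<le> A \<and> \<bar>snd x\<bar> \<le> A"
    and D1: "0 < D1" and D2: "0 < D2"
begin

sublocale dith: prob_space "dith D1 D2" by (rule prob_space_dith[OF D1 D2])
sublocale PD: pair_sigma_finite P "dith D1 D2" ..
sublocale PL: pair_sigma_finite P "lborel :: (real \<times> real) measure" ..

lemma space_P [simp]: "space P = UNIV"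
  using sets_eq_imp_space_eq[OF sets_P] by simp

lemma measurable_P_fst_snd [measurable]: "fst \<in> borel_measurable P" "snd \<in> borel_measurable P"
  by (simp_all add: measurable_cong_sets[OF sets_P refl] borel_prod[symmetric])

definition cell_vol :: real where "cell_vol = 12 * sqrt (D1 * D2)"

lemma cell_vol_pos: "0 < cell_vol"
  using D1 D2 by (simp add: cell_vol_def)

text \<open>Up to the factor \<^term>\<open>cell_vol\<close>, the density of source plus dither.\<close>
definition cellprob :: "real \<times> real \<Rightarrow> real" where
  "cellprob w = prob {x. w - x \<in> cell D1 D2}"

lemma cell_shift_events [measurable]: "{x. w - x \<in> cell D1 D2} \<in> events"
proof -
  have "{x \<in> space P. w - x \<in> cell D1 D2} \<in> events" by measurable
  then show ?thesis by simp
qed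

lemma nn_integral_cell_indicator:
  "(\<integral>\<^sup>+x. indicator (cell D1 D2) (w - x) \<partial>P) = ennreal (cellprob w)"
proof -
  have "(\<integral>\<^sup>+x. indicator (cell D1 D2) (w - x) \<partial>P) = (\<integral>\<^sup>+x. indicator {x. w - x \<in> cell D1 D2} x \<partial>P)"
    by (intro nn_integral_cong) (auto simp: indicator_def)
  then show ?thesis by (simp add: cellprob_def emeasure_eq_measure)
qed

lemma cellprob_bounds: "0 \<le> cellprob w" "cellprob w \<le> 1"
  by (auto simp: cellprob_def)

lemma measurable_cellprob [measurable]: "cellprob \<in> borel_measurable borel"
proof -
  have "(\<lambda>w. enn2real (\<integral>\<^sup>+x. indicator (cell D1 D2) (w - x) \<partial>P)) \<in> borel_measurable borel"
    by measurable
  then show ?thesis by (simp add: nn_integral_cell_indicator cellprob_bounds)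
qed

text \<open>In other words, source plus dither has density \<open>cellprob w / cell_vol\<close>:
  substitute \<open>w = x + z\<close>, then exchange the integrals by Tonelli.\<close>

lemma nn_integral_convolution:
  assumes [measurable]: "F \<in> borel_measurable borel"
  shows "(\<integral>\<^sup>+x. \<integral>\<^sup>+z. F (x + z) \<partial>dith D1 D2 \<partial>P) = (\<integral>\<^sup>+w. F w * ennreal (cellprob w) \<partial>lborel) / ennreal cell_vol"
proof -
  have "(\<integral>\<^sup>+z. F (x + z) \<partial>dith D1 D2) = (\<integral>\<^sup>+w. F w * indicator (cell D1 D2) (w - x) \<partial>lborel) / ennreal cell_vol" for x
    using nn_integral_lborel_shift[of "\<lambda>w. F w * indicator (cell D1 D2) (w - x)" x]
    by (subst nn_integral_dith) (auto simp: D1 D2 cell_vol_def)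
  then have "(\<integral>\<^sup>+x. \<integral>\<^sup>+z. F (x + z) \<partial>dith D1 D2 \<partial>P) =
      (\<integral>\<^sup>+x. \<integral>\<^sup>+w. F w * indicator (cell D1 D2) (w - x) \<partial>lborel \<partial>P) / ennreal cell_vol"
    by (simp add: nn_integral_divide)
  also have "(\<integral>\<^sup>+x. \<integral>\<^sup>+w. F w * indicator (cell D1 D2) (w - x) \<partial>lborel \<partial>P) =
      (\<integral>\<^sup>+w. \<integral>\<^sup>+x. F w * indicator (cell D1 D2) (w - x) \<partial>P \<partial>lborel)"
    by (rule PL.Fubini'[symmetric]) measurable
  also have "\<dots> = (\<integral>\<^sup>+w. F w * ennreal (cellprob w) \<partial>lborel)"
    by (simp add: nn_integral_cmult nn_integral_cell_indicator)
  finally show ?thesis .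
qed

text \<open>Self-information in nats. Since \<open>ln 0 = 0\<close>, it is 0 where
  \<open>cellprob\<close> vanishes; source plus dither almost surely avoids that set.\<close>

definition info :: "real \<times> real \<Rightarrow> real" where "info w = - ln (cellprob w)"

lemma info_nonneg: "0 \<le> info w"
  using cellprob_bounds[of w] by (cases "cellprob w = 0") (auto simp: info_def)

lemma measurable_info [measurable]: "info \<in> borel_measurable borel"
  unfolding info_def[abs_def] by measurable

lemma cellprob_eq_0:
  assumes "w \<notin> {- (A + sqrt (3 * D1)) .. A + sqrt (3 * D1)} \<times> {- (A + sqrt (3 * D2)) .. A + sqrt (3 * D2)}"
  shows "cellprob w = 0"
proof -
  have "AE x in P. x \<notin> {x. w - x \<in> cell D1 D2}"
    using bounded by eventually_elim (use assms in \<open>auto simp: cell_def mem_Times_iff\<close>)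
  then have "{x. w - x \<in> cell D1 D2} \<in> null_sets P"
    by (subst AE_iff_null_sets) auto
  then show ?thesis by (auto simp: cellprob_def intro: measure_eq_0_null_sets)
qed

text \<open>The integrand is at most 1 and vanishes outside a bounded rectangle.\<close>

lemma nn_integral_info_finite: "(\<integral>\<^sup>+w. ennreal (info w * cellprob w) \<partial>lborel) < \<infinity>"
proof -
  let ?S = "{- (A + sqrt (3 * D1)) .. A + sqrt (3 * D1)} \<times> {- (A + sqrt (3 * D2)) .. A + sqrt (3 * D2)}"
  have [measurable]: "?S \<in> sets borel" by (auto simp: borel_Times)
  have "ennreal (info w * cellprob w) \<le> indicator ?S w" for w
    using cellprob_eq_0[of w] neg_mult_ln_bounds(2)[OF cellprob_bounds, of w]
    by (auto simp: info_def indicator_def mult.commute)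
  then have "(\<integral>\<^sup>+w. ennreal (info w * cellprob w) \<partial>lborel) \<le> (\<integral>\<^sup>+w. indicator ?S w \<partial>lborel)"
    by (intro nn_integral_mono)
  also have "\<dots> = emeasure lborel ?S" by (rule nn_integral_indicator) (simp add: borel_Times)
  also have "\<dots> < \<infinity>"
    by (subst emeasure_lborel_Times) (auto simp: ennreal_mult_less_top emeasure_lborel_Icc_eq)
  finally show ?thesis .
qed

definition ell :: "real \<times> real \<Rightarrow> real" where
  "ell x = (\<integral>z. info (x + z) \<partial>dith D1 D2)"

text \<open>Finiteness is transported by the convolution formula. Fubini then yields integrability
  of \<open>ell\<close> and, for almost every \<open>x\<close>, of the integrand defining
  \<open>ell x\<close>.\<close>

lemma integrable_pair_info: "integrable (P \<Otimes>\<^sub>M dith D1 D2) (\<lambda>y. info (fst y + snd y))"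
proof (rule integrableI_nonneg)
  show "(\<integral>\<^sup>+y. ennreal (info (fst y + snd y)) \<partial>(P \<Otimes>\<^sub>M dith D1 D2)) < \<infinity>"
    by (subst dith.nn_integral_fst[symmetric], measurable)
      (use nn_integral_convolution[of "\<lambda>w. ennreal (info w)"] nn_integral_info_finite cell_vol_pos in
        \<open>auto simp: ennreal_mult[symmetric] info_nonneg cellprob_bounds ennreal_divide_eq_top_iff less_top[symmetric]\<close>)
qed (auto simp: info_nonneg)

lemma integrable_ell: "integrable P ell"
  using PD.integrable_fst'[OF integrable_pair_info] by (simp add: ell_def[abs_def])

lemma AE_integrable_info: "AE x in P. integrable (dith D1 D2) (\<lambda>z. info (x + z))"
  using PD.AE_integrable_fst'[OF integrable_pair_info] by simp

lemma expectation_ell: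
  "ennreal (expectation ell) = (\<integral>\<^sup>+w. ennreal (info w * cellprob w) \<partial>lborel) / ennreal cell_vol"
proof -
  have "expectation ell = (\<integral>y. info (fst y + snd y) \<partial>(P \<Otimes>\<^sub>M dith D1 D2))"
    using PD.integral_fst'[OF integrable_pair_info] by (simp add: ell_def[abs_def])
  also have "ennreal \<dots> = (\<integral>\<^sup>+y. ennreal (info (fst y + snd y)) \<partial>(P \<Otimes>\<^sub>M dith D1 D2))"
    by (rule nn_integral_eq_integral[symmetric, OF integrable_pair_info]) (simp add: info_nonneg)
  also have "\<dots> = (\<integral>\<^sup>+x. \<integral>\<^sup>+z. ennreal (info (x + z)) \<partial>dith D1 D2 \<partial>P)"
    by (subst dith.nn_integral_fst[symmetric]) auto
  also have "\<dots> = (\<integral>\<^sup>+w. ennreal (info w * cellprob w) \<partial>lborel) / ennreal cell_vol"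
    by (subst nn_integral_convolution) (auto simp: ennreal_mult info_nonneg cellprob_bounds)
  finally show ?thesis .
qed

text \<open>Averaging a squared error over the dither adds exactly \<open>D1\<close> or
  \<open>D2\<close>, so the exponent is the dither mean of \<open>info - q\<close>. After Jensen,
  the factor \<open>exp (info w)\<close> cancels the density \<open>cellprob w\<close>, and a pure
  Gaussian remains.\<close>

lemma exp_ell_bound:
  fixes a :: "real \<times> real"
  assumes V: "0 < V1" "0 < V2"
  shows "(\<integral>\<^sup>+x. ennreal (exp (ell x - ((fst x - fst a)\<^sup>2 + D1) / (2 * V1) - ((snd x - snd a)\<^sup>2 + D2) / (2 * V2))) \<partial>P)
    \<le> ennreal (2 * pi * sqrt (V1 * V2) / cell_vol)"
proof -
  define q where "q w = (fst w - fst a)\<^sup>2 / (2 * V1) + (snd w - snd a)\<^sup>2 / (2 * V2)" for w :: "real \<times> real"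
  have [measurable]: "q \<in> borel_measurable borel"
    unfolding q_def[abs_def] by (simp add: borel_prod[symmetric])
  have qz: "q (x + z) = ((fst x - fst a) + fst z)\<^sup>2 / (2 * V1) + ((snd x - snd a) + snd z)\<^sup>2 / (2 * V2)" for x z
    by (simp add: q_def algebra_simps)
  have q: "integrable (dith D1 D2) (\<lambda>z. q (x + z))" for x
    unfolding qz
    by (intro Bochner_Integration.integrable_add integrable_divide dith_second_moments D1 D2)
  have q2: "(\<integral>z. q (x + z) \<partial>dith D1 D2) = ((fst x - fst a)\<^sup>2 + D1) / (2 * V1) + ((snd x - snd a)\<^sup>2 + D2) / (2 * V2)" for x
    unfolding qz
    by (subst Bochner_Integration.integral_add)
      (auto intro!: dith_second_moments D1 D2 simp: dith_second_moments D1 D2)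
  have "(\<integral>\<^sup>+x. ennreal (exp (ell x - ((fst x - fst a)\<^sup>2 + D1) / (2 * V1) - ((snd x - snd a)\<^sup>2 + D2) / (2 * V2))) \<partial>P)
     \<le> (\<integral>\<^sup>+x. \<integral>\<^sup>+z. ennreal (exp (info (x + z) - q (x + z))) \<partial>dith D1 D2 \<partial>P)"
  proof (rule nn_integral_mono_AE)
    show "AE x in P. ennreal (exp (ell x - ((fst x - fst a)\<^sup>2 + D1) / (2 * V1) - ((snd x - snd a)\<^sup>2 + D2) / (2 * V2)))
      \<le> (\<integral>\<^sup>+z. ennreal (exp (info (x + z) - q (x + z))) \<partial>dith D1 D2)"
      using AE_integrable_info
    proof eventually_elim
      case (elim x)
      have "(\<integral>z. info (x + z) - q (x + z) \<partial>dith D1 D2) = ell x - ((fst x - fst a)\<^sup>2 + D1) / (2 * V1) - ((snd x - snd a)\<^sup>2 + D2) / (2 * V2)"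
        using elim q q2 by (simp add: ell_def)
      then show ?case
        using dith.exp_expectation_le[OF Bochner_Integration.integrable_diff[OF elim q[of x]]] by simp
    qed
  qed
  also have "\<dots> = (\<integral>\<^sup>+w. ennreal (exp (info w - q w)) * ennreal (cellprob w) \<partial>lborel) / ennreal cell_vol"
    by (rule nn_integral_convolution) measurable
  also have "\<dots> \<le> (\<integral>\<^sup>+w. ennreal (exp (- ((fst w - fst a)\<^sup>2 / (2 * V1)) - (snd w - snd a)\<^sup>2 / (2 * V2))) \<partial>lborel) / ennreal cell_vol"
  proof (intro divide_right_mono_ennreal nn_integral_mono)
    fix w
    \<comment> \<open>Equality where \<open>cellprob w\<close> is positive; elsewhere the left side
      is 0.\<close>
    have "exp (info w - q w) * cellprob w \<le> exp (- q w)"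
    proof (cases "cellprob w = 0")
      case False
      then have "0 < cellprob w" using cellprob_bounds[of w] by simp
      then show ?thesis by (simp add: info_def exp_diff exp_minus field_simps)
    qed simp
    then show "ennreal (exp (info w - q w)) * ennreal (cellprob w) \<le>
       ennreal (exp (- ((fst w - fst a)\<^sup>2 / (2 * V1)) - (snd w - snd a)\<^sup>2 / (2 * V2)))"
      by (simp add: ennreal_mult[symmetric] cellprob_bounds q_def)
  qed
  also have "\<dots> = ennreal (2 * pi * sqrt (V1 * V2) / cell_vol)"
    using V cell_vol_pos by (simp add: nn_integral_gaussian2 divide_ennreal)
  finally show ?thesis .
qed

end

section \<open>Boundedness and measurability of discrete entropy\<close>

lemma (in prob_space) dent_bounds:
  assumes "finite F" "AE x in M. U x \<in> F"
  shows "0 \<le> dent M U" "dent M U \<le> card F / ln 2"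
proof -
  define m where "m u = prob {x \<in> space M. U x = u}" for u
  have E: "dent M U = (\<Sum>u\<in>F. - (m u * ln (m u)) / ln 2)"
    unfolding dent_finite[OF assms] by (simp add: m_def log_def)
  have m: "0 \<le> - (m u * ln (m u))" "- (m u * ln (m u)) \<le> 1" for u
    by (rule neg_mult_ln_bounds; simp add: m_def)+
  have "(\<Sum>u\<in>F. - (m u * ln (m u)) / ln 2) \<le> (\<Sum>u\<in>F. 1 / ln 2)"
    by (intro sum_mono divide_right_mono m) simp
  then show "dent M U \<le> card F / ln 2" unfolding E by simp
  show "0 \<le> dent M U" unfolding E by (intro sum_nonneg divide_nonneg_pos m) simp
qed

text \<open>For each \<open>z\<close> the finite sum over \<open>G n\<close> equals the entropy once
  \<open>n\<close> is large. The entropy is thus a pointwise limit of finite sums of measurable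
  functions.\<close>

lemma (in prob_space) measurable_dent:
  assumes U: "\<And>y. Measurable.pred (N \<Otimes>\<^sub>M M) (\<lambda>(z, x). U z x = y)"
    and fin: "\<And>n. finite (G n)"
    and mem: "\<And>z. \<forall>\<^sub>F n::nat in sequentially. AE x in M. U z x \<in> G n"
  shows "(\<lambda>z. dent M (U z)) \<in> borel_measurable N"
proof (rule borel_measurable_LIMSEQ_real)
  fix n
  have [measurable]: "(\<lambda>z. prob {x \<in> space M. U z x = u}) \<in> borel_measurable N" for u
  proof -
    have "(\<lambda>z. enn2real (emeasure M {x \<in> space M. U z x = u})) \<in> borel_measurable N"
    proof (intro borel_measurable_enn2real measurable_emeasure)
      have "{y \<in> space (N \<Otimes>\<^sub>M M). snd y \<in> {x \<in> space M. U (fst y) x = u}} =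
          {y \<in> space (N \<Otimes>\<^sub>M M). case y of (z, x) \<Rightarrow> U z x = u}"
        by (auto simp: space_pair_measure)
      then show "{y \<in> space (N \<Otimes>\<^sub>M M). snd y \<in> {x \<in> space M. U (fst y) x = u}} \<in> sets (N \<Otimes>\<^sub>M M)"
        using U[of u] by (simp add: pred_def)
    qed simp
    then show ?thesis by (simp add: measure_def)
  qed
  show "(\<lambda>z. \<Sum>u\<in>G n. - (prob {x \<in> space M. U z x = u} * log 2 (prob {x \<in> space M. U z x = u})))
      \<in> borel_measurable N"
    by measurable
next
  fix z
  have "\<forall>\<^sub>F n in sequentially. dent M (U z) =
      (\<Sum>u\<in>G n. - (prob {x \<in> space M. U z x = u} * log 2 (prob {x \<in> space M. U z x = u})))"
    using mem[of z] by eventually_elim (simp add: dent_finite[OF fin])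
  then show "(\<lambda>n. \<Sum>u\<in>G n. - (prob {x \<in> space M. U z x = u} * log 2 (prob {x \<in> space M. U z x = u})))
      \<longlonglongrightarrow> dent M (U z)"
    by (rule Lim_transform_eventually[OF tendsto_const])
qed

context bounded_source
begin

subsection \<open>Entropies of the dithered quantizer outputs\<close>

abbreviation Y1 :: "real \<times> real \<Rightarrow> real \<times> real \<Rightarrow> real" where
  "Y1 z x \<equiv> quant D1 (fst x + fst z)"
abbreviation Y2 :: "real \<times> real \<Rightarrow> real \<times> real \<Rightarrow> real" where
  "Y2 z x \<equiv> quant D2 (snd x + snd z)"

lemma AE_Y_lattice:
  assumes "\<bar>fst z\<bar> + A + sqrt (3 * D1) \<le> C" "\<bar>snd z\<bar> + A + sqrt (3 * D2) \<le> C"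
  shows "AE x in P. Y1 z x \<in> lattice_pts D1 C" "AE x in P. Y2 z x \<in> lattice_pts D2 C"
proof -
  show "AE x in P. Y1 z x \<in> lattice_pts D1 C"
    using bounded by eventually_elim (rule quant_in_lattice_pts[OF D1], use assms in linarith)
  show "AE x in P. Y2 z x \<in> lattice_pts D2 C"
    using bounded by eventually_elim (rule quant_in_lattice_pts[OF D2], use assms in linarith)
qed

lemma eventually_AE_Y_lattice:
  "\<forall>\<^sub>F n::nat in sequentially. (AE x in P. Y1 z x \<in> lattice_pts D1 n) \<and> (AE x in P. Y2 z x \<in> lattice_pts D2 n)"
proof -
  have "\<forall>\<^sub>F n::nat in sequentially. \<bar>fst z\<bar> + \<bar>snd z\<bar> + A + sqrt (3 * D1) + sqrt (3 * D2) \<le> real n"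
    by (rule filterlim_real_sequentially[THEN filterlim_at_top[THEN iffD1, rule_format]])
  then show ?thesis
  proof eventually_elim
    case (elim n)
    have "0 < sqrt (3 * D1)" "0 < sqrt (3 * D2)" using D1 D2 by auto
    then have "\<bar>fst z\<bar> + A + sqrt (3 * D1) \<le> n" "\<bar>snd z\<bar> + A + sqrt (3 * D2) \<le> n"
      using elim by linarith+
    then show ?case by (blast intro: AE_Y_lattice)
  qed
qed

lemma measurable_fst_snd_pair [measurable]:
  "(\<lambda>y. fst (snd y)) \<in> borel_measurable ((borel :: (real \<times> real) measure) \<Otimes>\<^sub>M P)"
  "(\<lambda>y. snd (snd y)) \<in> borel_measurable ((borel :: (real \<times> real) measure) \<Otimes>\<^sub>M P)"
  "(\<lambda>y. fst (fst y)) \<in> borel_measurable ((borel :: (real \<times> real) measure) \<Otimes>\<^sub>M P)"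
  "(\<lambda>y. snd (fst y)) \<in> borel_measurable ((borel :: (real \<times> real) measure) \<Otimes>\<^sub>M P)"
  by (auto intro!: measurable_compose[OF measurable_snd] measurable_compose[OF measurable_fst])

lemma measurable_dent_Y1 [measurable]: "(\<lambda>z. dent P (Y1 z)) \<in> borel_measurable borel"
proof (rule measurable_dent)
  show "Measurable.pred (borel \<Otimes>\<^sub>M P) (\<lambda>(z, x). Y1 z x = y)" for y by measurable
  show "finite (lattice_pts D1 (real n))" for n by (rule finite_lattice_pts[OF D1])
  show "\<forall>\<^sub>F n::nat in sequentially. AE x in P. Y1 z x \<in> lattice_pts D1 (real n)" for z
    using eventually_AE_Y_lattice[of z] by eventually_elim auto
qed

lemma measurable_dent_Y12 [measurable]: "(\<lambda>z. dent P (\<lambda>x. (Y1 z x, Y2 z x))) \<in> borel_measurable borel"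
proof (rule measurable_dent)
  show "Measurable.pred (borel \<Otimes>\<^sub>M P) (\<lambda>(z, x). (Y1 z x, Y2 z x) = y)" for y
    by (cases y) simp
  show "finite (lattice_pts D1 (real n) \<times> lattice_pts D2 (real n))" for n
    by (intro finite_cartesian_product finite_lattice_pts D1 D2)
  show "\<forall>\<^sub>F n::nat in sequentially. AE x in P. (Y1 z x, Y2 z x) \<in> lattice_pts D1 (real n) \<times> lattice_pts D2 (real n)" for z
    using eventually_AE_Y_lattice[of z] by eventually_elim auto
qed

text \<open>Source bound, dither bound and quantization error add up to at most this in either
  coordinate; adding both axes gives one radius for both.\<close>

definition rad :: real where
  "rad = A + 2 * sqrt (3 * D1) + 2 * sqrt (3 * D2)"

lemma AE_Y_dith:
  "AE z in dith D1 D2. (AE x in P. Y1 z x \<in> lattice_pts D1 rad) \<and> (AE x in P. Y2 z x \<in> lattice_pts D2 rad)"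
  using AE_dith[OF D1 D2]
proof eventually_elim
  case (elim z)
  have "0 < sqrt (3 * D1)" "0 < sqrt (3 * D2)" using D1 D2 by auto
  then show ?case using elim by (auto intro!: AE_Y_lattice simp: rad_def)
qed

lemma integrable_dent_Y1: "integrable (dith D1 D2) (\<lambda>z. dent P (Y1 z))"
proof (rule dith.integrable_const_bound)
  show "AE z in dith D1 D2. norm (dent P (Y1 z)) \<le> card (lattice_pts D1 rad) / ln 2"
    using AE_Y_dith
    by eventually_elim (use dent_bounds[OF finite_lattice_pts[OF D1]] in auto)
qed measurable

lemma integrable_dent_Y12: "integrable (dith D1 D2) (\<lambda>z. dent P (\<lambda>x. (Y1 z x, Y2 z x)))"
proof (rule dith.integrable_const_bound)
  let ?G = "lattice_pts D1 rad \<times> lattice_pts D2 rad"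
  have fin: "finite ?G" by (intro finite_cartesian_product finite_lattice_pts D1 D2)
  show "AE z in dith D1 D2. norm (dent P (\<lambda>x. (Y1 z x, Y2 z x))) \<le> card ?G / ln 2"
    using AE_Y_dith
  proof eventually_elim
    case (elim z)
    have "AE x in P. (Y1 z x, Y2 z x) \<in> ?G" using elim by auto
    from dent_bounds[OF fin this] show ?case by simp
  qed
qed measurable

text \<open>Rewrites this entropy over the same planar dither as the others, so that the chain rule
  can be integrated over \<open>z\<close>.\<close>

lemma H_Y1_Z1_dith: "H_Y1_Z1 P D1 = (\<integral>z. dent P (Y1 z) \<partial>dith D1 D2)"
proof -
  have "(\<lambda>t. dent P (Y1 (t, 0))) \<in> borel_measurable borel"
    by (rule measurable_compose[OF _ measurable_dent_Y1, of "\<lambda>t. (t, 0)"]) measurable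
  then have "(\<lambda>t. dent P (\<lambda>x. quant D1 (fst x + t))) \<in> borel_measurable borel" by simp
  then show ?thesis unfolding H_Y1_Z1_def distr_dith_fst[OF D1 D2, symmetric]
    by (subst integral_distr) auto
qed

text \<open>The discrete chain rule holds for every single \<open>z\<close>, because the truncation
  level \<open>n\<close> may depend on \<open>z\<close>; integrability of both \<open>dent\<close>
  terms then lets the difference be integrated.\<close>

lemma entropy_chain_rule: "H_Y1Y2_Z P D1 D2 = H_Y2_Y1Z P D1 D2 + H_Y1_Z1 P D1"
proof -
  have "dcent P (Y2 z) (Y1 z) = dent P (\<lambda>x. (Y1 z x, Y2 z x)) - dent P (Y1 z)" for z
  proof -
    obtain n :: nat where "AE x in P. Y1 z x \<in> lattice_pts D1 n" "AE x in P. Y2 z x \<in> lattice_pts D2 n"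
      using eventually_AE_Y_lattice[of z] by (auto simp: eventually_sequentially)
    moreover have "{x \<in> space P. Y1 z x = u} \<in> events" "{x \<in> space P. Y2 z x = u} \<in> events" for u
      by measurable
    ultimately show ?thesis
      using dent_chain_rule[of "lattice_pts D2 n" "lattice_pts D1 n" "Y2 z" "Y1 z"]
        finite_lattice_pts[OF D1] finite_lattice_pts[OF D2] by simp
  qed
  then show ?thesis
    unfolding H_Y2_Y1Z_def H_Y1Y2_Z_def H_Y1_Z1_dith
    using integrable_dent_Y1 integrable_dent_Y12 by simp
qed

lemma prob_Y12:
  assumes "fst y \<in> lattice_pts D1 C" "snd y \<in> lattice_pts D2 C"
  shows "prob {x \<in> space P. (Y1 z x, Y2 z x) = y} = cellprob (y - z)"
proof -
  have "{x \<in> space P. (Y1 z x, Y2 z x) = y} = {x. (y - z) - x \<in> cell D1 D2}"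
    using assms
    by (cases y) (auto simp: quant_eq_iff D1 D2 lattice_pts_def cell_def mem_Times_iff algebra_simps)
  then show ?thesis by (simp add: cellprob_def)
qed

text \<open>Cells around distinct lattice points are disjoint, so at most one summand is
  nonzero.\<close>

lemma sum_cell_indicator_le:
  assumes "finite G" "G \<subseteq> lattice_pts D1 C \<times> lattice_pts D2 C"
  shows "(\<Sum>y\<in>G. indicator (cell D1 D2) (y - w) :: ennreal) \<le> 1"
proof (cases "\<exists>y\<in>G. y - w \<in> cell D1 D2")
  case True
  then obtain y where y: "y \<in> G" "y - w \<in> cell D1 D2" by blast
  have mem: "fst v \<in> lattice_pts D1 C" "snd v \<in> lattice_pts D2 C" if "v \<in> G" for v
    using subsetD[OF assms(2) that] by (simp_all add: mem_Times_iff)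
  have uniq: "y' = y" if "y' \<in> G" "y' - w \<in> cell D1 D2" for y'
    using that y mem[OF y(1)] mem[OF that(1)] box_separated_lattice[OF D1, of "fst y'" C "fst y" "fst w"]
      box_separated_lattice[OF D2, of "snd y'" C "snd y" "snd w"]
    by (auto simp: cell_def mem_Times_iff prod_eq_iff)
  have "(\<Sum>y'\<in>G. indicator (cell D1 D2) (y' - w) :: ennreal) = (\<Sum>y'\<in>{y}. indicator (cell D1 D2) (y' - w))"
  proof (rule sum.mono_neutral_right)
    show "\<forall>y'\<in>G - {y}. indicator (cell D1 D2) (y' - w) = (0 :: ennreal)"
      using uniq by (metis DiffE indicator_simps(2) singletonI)
  qed (use y assms(1) in auto)
  then show ?thesis using y by simp
next
  case False
  then have "(\<Sum>y\<in>G. indicator (cell D1 D2) (y - w) :: ennreal) = 0"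
    by (intro sum.neutral) (auto simp: indicator_def)
  then show ?thesis by simp
qed

text \<open>For fixed \<open>z\<close> the entropy is a sum of the function \<open>\<phi>\<close>
  over the points \<open>y - z\<close>. Averaging over \<open>z\<close> in a cell integrates
  \<open>\<phi>\<close> over translated cells; their disjointness bounds the total by the integral
  over the plane. This direction of the tiling identity is what the converse uses.\<close>

lemma entropy_le_expectation_ell: "ln 2 * H_Y1Y2_Z P D1 D2 \<le> expectation ell"
proof -
  define \<phi> where "\<phi> w = ennreal (info w * cellprob w)" for w
  have [measurable]: "\<phi> \<in> borel_measurable borel" unfolding \<phi>_def[abs_def] by measurable
  let ?G = "lattice_pts D1 rad \<times> lattice_pts D2 rad"
  have fin: "finite ?G" by (intro finite_cartesian_product finite_lattice_pts D1 D2)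
  have "ennreal (ln 2 * H_Y1Y2_Z P D1 D2) =
      ennreal (\<integral>z. ln 2 * dent P (\<lambda>x. (Y1 z x, Y2 z x)) \<partial>dith D1 D2)"
    unfolding H_Y1Y2_Z_def by simp
  also have "\<dots> \<le> (\<integral>\<^sup>+z. ennreal (ln 2 * dent P (\<lambda>x. (Y1 z x, Y2 z x))) \<partial>dith D1 D2)"
    by (rule ennreal_integral_le_nn_integral)
  also have "\<dots> = (\<integral>\<^sup>+z. (\<Sum>y\<in>?G. \<phi> (y - z)) \<partial>dith D1 D2)"
  proof (rule nn_integral_cong_AE)
    show "AE z in dith D1 D2. ennreal (ln 2 * dent P (\<lambda>x. (Y1 z x, Y2 z x))) = (\<Sum>y\<in>?G. \<phi> (y - z))"
      using AE_Y_dith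
    proof eventually_elim
      case (elim z)
      then have ae: "AE x in P. (Y1 z x, Y2 z x) \<in> ?G" by auto
      have pc: "prob {x \<in> space P. (Y1 z x, Y2 z x) = y} = cellprob (y - z)" if "y \<in> ?G" for y
        using that by (intro prob_Y12[where C = rad]) auto
      have "ln 2 * dent P (\<lambda>x. (Y1 z x, Y2 z x)) =
          ln 2 * (\<Sum>y\<in>?G. - (cellprob (y - z) * log 2 (cellprob (y - z))))"
        unfolding dent_finite[OF fin ae]
        by (intro arg_cong2[where f = "(*)"] refl sum.cong) (simp only: pc)
      also have "\<dots> = (\<Sum>y\<in>?G. info (y - z) * cellprob (y - z))"
        by (simp add: sum_distrib_left log_def info_def mult.commute)
      finally show ?case
        by (simp add: \<phi>_def info_nonneg cellprob_bounds)
    qed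
  qed
  also have "\<dots> = (\<integral>\<^sup>+z. (\<Sum>y\<in>?G. \<phi> (y - z)) * indicator (cell D1 D2) z \<partial>lborel) / ennreal cell_vol"
    by (subst nn_integral_dith) (auto simp: D1 D2 cell_vol_def)
  also have "(\<integral>\<^sup>+z. (\<Sum>y\<in>?G. \<phi> (y - z)) * indicator (cell D1 D2) z \<partial>lborel) =
      (\<Sum>y\<in>?G. \<integral>\<^sup>+z. \<phi> (y - z) * indicator (cell D1 D2) z \<partial>lborel)"
    by (simp add: sum_distrib_right nn_integral_sum)
  \<comment> \<open>Substitute \<open>w = y - z\<close> separately for each lattice point.\<close>
  also have "\<dots> = (\<Sum>y\<in>?G. \<integral>\<^sup>+w. \<phi> w * indicator (cell D1 D2) (y - w) \<partial>lborel)"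
  proof (rule sum.cong[OF refl])
    fix y
    show "(\<integral>\<^sup>+z. \<phi> (y - z) * indicator (cell D1 D2) z \<partial>lborel) = (\<integral>\<^sup>+w. \<phi> w * indicator (cell D1 D2) (y - w) \<partial>lborel)"
      using nn_integral_lborel_reflect[of "\<lambda>w. \<phi> w * indicator (cell D1 D2) (y - w)" y] by simp
  qed
  also have "\<dots> = (\<integral>\<^sup>+w. \<phi> w * (\<Sum>y\<in>?G. indicator (cell D1 D2) (y - w)) \<partial>lborel)"
    by (simp add: sum_distrib_left nn_integral_sum)
  also have "\<dots> / ennreal cell_vol \<le> (\<integral>\<^sup>+w. \<phi> w \<partial>lborel) / ennreal cell_vol"
  proof (intro divide_right_mono_ennreal nn_integral_mono)
    fix w
    show "\<phi> w * (\<Sum>y\<in>?G. indicator (cell D1 D2) (y - w)) \<le> \<phi> w"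
      using mult_left_mono[OF sum_cell_indicator_le[OF fin order.refl, of w], of "\<phi> w"] by simp
  qed
  also have "\<dots> = ennreal (expectation ell)"
    by (simp add: \<phi>_def expectation_ell)
  finally show ?thesis
    by (subst (asm) ennreal_le_iff)
      (auto intro!: Bochner_Integration.integral_nonneg simp: ell_def[abs_def] info_nonneg)
qed

end

context bounded_source
begin

subsection \<open>Converse bound for block codes\<close>

text \<open>The reproduction word depends on the whole block, which destroys independence.
  Dominating the exponential by the sum over all index pairs \<open>m\<close> freezes the word: each
  summand is then a product over letters, bounded by \<open>C ^ n\<close>, and there are
  \<open>M1 * M2\<close> of them.\<close>

lemma code_bound:
  fixes n M1 M2 :: nat and f1 f2 :: "(nat \<Rightarrow> real) \<Rightarrow> nat"
    and g :: "nat \<Rightarrow> nat \<Rightarrow> (nat \<Rightarrow> real) \<times> (nat \<Rightarrow> real)"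
  defines "Pn \<equiv> PiM {..<n} (\<lambda>_. P)"
  defines "h1 \<equiv> \<lambda>x. f1 (\<lambda>k. fst (x k))" and "h2 \<equiv> \<lambda>x. f2 (\<lambda>k. snd (x k))"
  assumes f: "\<And>u. f1 u \<in> {1..M1}" "\<And>u. f2 u \<in> {1..M2}"
    and h [measurable]: "h1 \<in> Pn \<rightarrow>\<^sub>M count_space UNIV" "h2 \<in> Pn \<rightarrow>\<^sub>M count_space UNIV"
    and V: "0 < V1" "0 < V2"
  shows "n * expectation ell \<le> ln M1 + ln M2 + n * ln (2 * pi * sqrt (V1 * V2) / cell_vol)
     + ((\<integral>x. (\<Sum>k<n. (fst (x k) - fst (g (h1 x) (h2 x)) k)\<^sup>2) \<partial>Pn) + n * D1) / (2 * V1)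
     + ((\<integral>x. (\<Sum>k<n. (snd (x k) - snd (g (h1 x) (h2 x)) k)\<^sup>2) \<partial>Pn) + n * D2) / (2 * V2)"
proof -
  interpret Pn: prob_space Pn unfolding Pn_def by (rule prob_space_PiM) (rule prob_space_axioms)
  interpret pp: product_sigma_finite "\<lambda>_::nat. P" by standard
  define C where "C = 2 * pi * sqrt (V1 * V2) / cell_vol"
  have C: "0 < C" using V cell_vol_pos by (simp add: C_def)
  define I where "I = {1..M1} \<times> {1..M2}"
  have hI: "(h1 x, h2 x) \<in> I" for x using f by (simp add: I_def h1_def h2_def)
  have M: "0 < M1" "0 < M2" using f(1)[of "\<lambda>_. 0"] f(2)[of "\<lambda>_. 0"] by auto
  define e1 e2 where "e1 x k = (fst (x k) - fst (g (h1 x) (h2 x)) k)\<^sup>2"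
    and "e2 x k = (snd (x k) - snd (g (h1 x) (h2 x)) k)\<^sup>2" for x :: "nat \<Rightarrow> real \<times> real" and k
  \<comment> \<open>The exponent of \<open>exp_ell_bound\<close> at letter \<open>y\<close>, with
    the \<open>k\<close>-th reproduction letter taken from word \<open>m\<close>.\<close>
  define t where "t m y k = ell y - ((fst y - fst (g (fst m) (snd m)) k)\<^sup>2 + D1) / (2 * V1)
     - ((snd y - snd (g (fst m) (snd m)) k)\<^sup>2 + D2) / (2 * V2)" for m y k
  have comp [measurable]: "(\<lambda>x. x k) \<in> Pn \<rightarrow>\<^sub>M P" if "k < n" for k
    unfolding Pn_def using that by simp
  have distr: "distr Pn P (\<lambda>x. x k) = P" if "k < n" for k
    unfolding Pn_def using that by (intro distr_PiM_component) (auto intro: prob_space_axioms)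
  have [measurable]: "ell \<in> borel_measurable P" using integrable_ell by auto
  have ell: "integrable Pn (\<lambda>x. ell (x k))" "Pn.expectation (\<lambda>x. ell (x k)) = expectation ell" if "k < n" for k
    using integrable_distr_eq[OF comp[OF that], of ell] integral_distr[OF comp[OF that], of ell]
    by (auto simp: distr[OF that] integrable_ell)
  \<comment> \<open>The decoder \<open>g\<close> is arbitrary, but it acts on measurable indices
    from a countable set.\<close>
  have gm [measurable]: "(\<lambda>x. fst (g (h1 x) (h2 x)) k) \<in> borel_measurable Pn"
    "(\<lambda>x. snd (g (h1 x) (h2 x)) k) \<in> borel_measurable Pn" for k
    by (rule measurable_compose_countable[OF measurable_compose_countable[OF _ h(2)] h(1)]; simp)+
  \<comment> \<open>A crude common bound for all reproduction letters, finite because there are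
    finitely many words. With the bounded source it makes the squared errors integrable.\<close>
  define B where "B = (\<Sum>m\<in>I. \<Sum>k<n. \<bar>fst (g (fst m) (snd m)) k\<bar> + \<bar>snd (g (fst m) (snd m)) k\<bar>)"
  have B: "\<bar>fst (g (h1 x) (h2 x)) k\<bar> \<le> B" "\<bar>snd (g (h1 x) (h2 x)) k\<bar> \<le> B" if "k < n" for x k
  proof -
    let ?b = "\<lambda>m k. \<bar>fst (g (fst m) (snd m)) k\<bar> + \<bar>snd (g (fst m) (snd m)) k\<bar>"
    have "?b (h1 x, h2 x) k \<le> (\<Sum>k<n. ?b (h1 x, h2 x) k)"
      using that by (intro member_le_sum) auto
    also have "\<dots> \<le> B" unfolding B_def
      by (rule member_le_sum[OF hI, where f = "\<lambda>m. \<Sum>k<n. ?b m k"]) (auto simp: sum_nonneg I_def)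
    finally show "\<bar>fst (g (h1 x) (h2 x)) k\<bar> \<le> B" "\<bar>snd (g (h1 x) (h2 x)) k\<bar> \<le> B" by auto
  qed
  have bnd: "AE x in Pn. \<bar>fst (x k)\<bar> \<le> A \<and> \<bar>snd (x k)\<bar> \<le> A" if "k < n" for k
    unfolding Pn_def using that by (intro AE_PiM_component bounded) (auto intro: prob_space_axioms)
  have sq: "\<bar>u - v\<bar>\<^sup>2 \<le> (A + B)\<^sup>2" if "\<bar>u\<bar> \<le> A" "\<bar>v\<bar> \<le> B" for u v :: real
    using that by (intro power_mono) auto
  have e1: "integrable Pn (\<lambda>x. e1 x k)" if "k < n" for k
  proof (rule Pn.integrable_const_bound)
    show "AE x in Pn. norm (e1 x k) \<le> (A + B)\<^sup>2"
      using bnd[OF that] by eventually_elim (use sq B(1)[OF that] in \<open>auto simp: e1_def\<close>)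
  qed (use that in \<open>auto simp: e1_def\<close>)
  have e2: "integrable Pn (\<lambda>x. e2 x k)" if "k < n" for k
  proof (rule Pn.integrable_const_bound)
    show "AE x in Pn. norm (e2 x k) \<le> (A + B)\<^sup>2"
      using bnd[OF that] by eventually_elim (use sq B(2)[OF that] in \<open>auto simp: e2_def\<close>)
  qed (use that in \<open>auto simp: e2_def\<close>)
  have T: "t (h1 x, h2 x) (x k) k = ell (x k) - (e1 x k + D1) / (2 * V1) - (e2 x k + D2) / (2 * V2)" for x k
    by (simp add: t_def e1_def e2_def)
  have Ti: "integrable Pn (\<lambda>x. t (h1 x, h2 x) (x k) k)" if "k < n" for k
    unfolding T using ell(1)[OF that] e1[OF that] e2[OF that] by auto
  have TE: "Pn.expectation (\<lambda>x. t (h1 x, h2 x) (x k) k) =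
     expectation ell - (Pn.expectation (\<lambda>x. e1 x k) + D1) / (2 * V1) - (Pn.expectation (\<lambda>x. e2 x k) + D2) / (2 * V2)"
    if "k < n" for k
    unfolding T using ell[OF that] e1[OF that] e2[OF that] by (simp add: Pn.prob_space)
  have tm [measurable]: "(\<lambda>y. t m y k) \<in> borel_measurable P" for m k
    unfolding t_def by measurable
  have "ennreal (exp (Pn.expectation (\<lambda>x. \<Sum>k<n. t (h1 x, h2 x) (x k) k))) \<le>
      (\<integral>\<^sup>+x. ennreal (exp (\<Sum>k<n. t (h1 x, h2 x) (x k) k)) \<partial>Pn)"
    by (rule Pn.exp_expectation_le) (auto intro!: Ti)
  also have "\<dots> \<le> (\<integral>\<^sup>+x. (\<Sum>m\<in>I. \<Prod>k<n. ennreal (exp (t m (x k) k))) \<partial>Pn)"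
  proof (rule nn_integral_mono)
    fix x
    have "ennreal (exp (\<Sum>k<n. t (h1 x, h2 x) (x k) k)) = (\<Prod>k<n. ennreal (exp (t (h1 x, h2 x) (x k) k)))"
      by (simp add: exp_sum prod_ennreal)
    \<comment> \<open>The word actually sent contributes one of these nonnegative summands.\<close>
    also have "\<dots> \<le> (\<Sum>m\<in>I. \<Prod>k<n. ennreal (exp (t m (x k) k)))"
      by (rule member_le_sum[OF hI]) (auto simp: I_def)
    finally show "ennreal (exp (\<Sum>k<n. t (h1 x, h2 x) (x k) k)) \<le> \<dots>" .
  qed
  also have "\<dots> = (\<Sum>m\<in>I. \<integral>\<^sup>+x. (\<Prod>k<n. ennreal (exp (t m (x k) k))) \<partial>Pn)"
    by (rule nn_integral_sum) measurable
  also have "\<dots> \<le> (\<Sum>m\<in>I. ennreal (C ^ n))"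
  proof (rule sum_mono)
    fix m
    have "(\<integral>\<^sup>+x. (\<Prod>k<n. ennreal (exp (t m (x k) k))) \<partial>Pn) = (\<Prod>k<n. \<integral>\<^sup>+y. ennreal (exp (t m y k)) \<partial>P)"
      unfolding Pn_def by (rule pp.product_nn_integral_prod) auto
    also have "\<dots> \<le> (\<Prod>k<n. ennreal C)"
    proof (rule prod_mono_ennreal)
      fix k
      show "(\<integral>\<^sup>+y. ennreal (exp (t m y k)) \<partial>P) \<le> ennreal C"
        using exp_ell_bound[OF V, of "(fst (g (fst m) (snd m)) k, snd (g (fst m) (snd m)) k)"]
        by (simp add: t_def C_def)
    qed
    finally show "(\<integral>\<^sup>+x. (\<Prod>k<n. ennreal (exp (t m (x k) k))) \<partial>Pn) \<le> ennreal (C ^ n)"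
      using C by (simp add: ennreal_power)
  qed
  also have "\<dots> = ennreal (real M1 * real M2 * C ^ n)"
    using C by (simp add: I_def ennreal_mult ennreal_of_nat_eq_real_of_nat)
  finally have "exp (Pn.expectation (\<lambda>x. \<Sum>k<n. t (h1 x, h2 x) (x k) k)) \<le> real M1 * real M2 * C ^ n"
    using C by (subst (asm) ennreal_le_iff) auto
  then have "Pn.expectation (\<lambda>x. \<Sum>k<n. t (h1 x, h2 x) (x k) k) \<le> ln (real M1 * real M2 * C ^ n)"
    using C M by (subst ln_ge_iff) auto
  also have "\<dots> = ln M1 + ln M2 + n * ln C"
    using C M by (simp add: ln_mult ln_realpow)
  finally have 1: "Pn.expectation (\<lambda>x. \<Sum>k<n. t (h1 x, h2 x) (x k) k) \<le> ln M1 + ln M2 + n * ln C" .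
  have "Pn.expectation (\<lambda>x. \<Sum>k<n. t (h1 x, h2 x) (x k) k) = (\<Sum>k<n. Pn.expectation (\<lambda>x. t (h1 x, h2 x) (x k) k))"
    by (rule Bochner_Integration.integral_sum) (auto intro: Ti)
  also have "\<dots> = (\<Sum>k<n. expectation ell - (Pn.expectation (\<lambda>x. e1 x k) + D1) / (2 * V1) - (Pn.expectation (\<lambda>x. e2 x k) + D2) / (2 * V2))"
    by (rule sum.cong) (auto simp: TE)
  also have "\<dots> = n * expectation ell - ((\<Sum>k<n. Pn.expectation (\<lambda>x. e1 x k)) + n * D1) / (2 * V1)
      - ((\<Sum>k<n. Pn.expectation (\<lambda>x. e2 x k)) + n * D2) / (2 * V2)"
    by (simp add: sum_subtractf sum.distrib sum_divide_distrib[symmetric])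
  also have "(\<Sum>k<n. Pn.expectation (\<lambda>x. e1 x k)) = Pn.expectation (\<lambda>x. \<Sum>k<n. e1 x k)"
    by (rule Bochner_Integration.integral_sum[symmetric]) (auto intro: e1)
  also have "(\<Sum>k<n. Pn.expectation (\<lambda>x. e2 x k)) = Pn.expectation (\<lambda>x. \<Sum>k<n. e2 x k)"
    by (rule Bochner_Integration.integral_sum[symmetric]) (auto intro: e2)
  finally show ?thesis using 1 by (simp add: C_def e1_def e2_def)
qed

section \<open>The constants and the limit of vanishing slack\<close>

text \<open>Since \<open>cell_vol\<close> is \<open>12 * sqrt (D1 * D2)\<close>, the quotient
  \<open>2 * pi / 12\<close> gives the factor \<open>pi / 6\<close> in each constant. The 1 is the
  sum of the two distortion terms, one half each, and becomes the factor
  \<open>exp 1\<close>.\<close>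

lemma cconst_eq:
  assumes "0 < V1" "0 < V2"
  shows "(1 + ln (2 * pi * sqrt (V1 * V2) / cell_vol)) / ln 2 = cconst (V1 - D1) D1 + cconst (V2 - D2) D2"
proof -
  have c: "cconst (V - D) D = (1 + ln pi - ln 6 + ln V - ln D) / 2 / ln 2" if "0 < V" "0 < D" for V D
  proof -
    have "pi * exp 1 / 6 * ((V - D) / D + 1) = pi * exp 1 * V / (6 * D)"
      using that by (simp add: field_simps)
    then show ?thesis unfolding cconst_def using that
      by (simp add: log_def ln_mult ln_div)
  qed
  have "ln (2 * pi * sqrt (V1 * V2) / cell_vol) = ln pi + (ln V1 + ln V2) / 2 - (ln 6 + (ln D1 + ln D2) / 2)"
    unfolding cell_vol_def using assms D1 D2 by (simp add: ln_mult ln_div ln_sqrt)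
  then have "1 + ln (2 * pi * sqrt (V1 * V2) / cell_vol) =
      (1 + ln pi - ln 6 + ln V1 - ln D1) / 2 + (1 + ln pi - ln 6 + ln V2 - ln D2) / 2"
    by (simp add: field_simps)
  then show ?thesis using assms D1 D2 by (simp only: c add_divide_distrib)
qed

text \<open>Valid at arbitrary levels \<open>d1\<close>, \<open>d2\<close>: apply the block bound
  with slack \<open>\<delta>\<close>, divide by \<open>n\<close>, and let \<open>\<delta>\<close>
  tend to 0.\<close>

lemma achievable_bound:
  assumes ach: "achievable P d1 d2 R1 R2"
  shows "H_Y1Y2_Z P D1 D2 \<le> R1 + R2 + cconst d1 D1 + cconst d2 D2"
proof -
  have step: "0 \<le> d1 + \<delta> \<and> 0 \<le> d2 + \<delta> \<and>
      H_Y1Y2_Z P D1 D2 \<le> R1 + R2 + 2 * \<delta> + cconst (d1 + \<delta>) D1 + cconst (d2 + \<delta>) D2"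
    if \<delta>: "0 < \<delta>" for \<delta> :: real
  proof -
    from ach \<delta> obtain N where N: "\<forall>n\<ge>N. \<exists>(M1::nat) (M2::nat) (f1::(nat \<Rightarrow> real) \<Rightarrow> nat) (f2::(nat \<Rightarrow> real) \<Rightarrow> nat)
        (g :: nat \<Rightarrow> nat \<Rightarrow> (nat \<Rightarrow> real) \<times> (nat \<Rightarrow> real)).
      1 \<le> M1 \<and> 1 \<le> M2 \<and> (\<forall>u. f1 u \<in> {1..M1}) \<and> (\<forall>u. f2 u \<in> {1..M2}) \<and>
      (\<lambda>x. f1 (\<lambda>k. fst (x k))) \<in> PiM {..<n} (\<lambda>_. P) \<rightarrow>\<^sub>M count_space UNIV \<and>
      (\<lambda>x. f2 (\<lambda>k. snd (x k))) \<in> PiM {..<n} (\<lambda>_. P) \<rightarrow>\<^sub>M count_space UNIV \<and>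
      (1 / real n) * (\<integral>x. (\<Sum>k<n. (fst (x k) -
          fst (g (f1 (\<lambda>k. fst (x k))) (f2 (\<lambda>k. snd (x k)))) k)^2) \<partial>PiM {..<n} (\<lambda>_. P)) \<le> d1 + \<delta> \<and>
      (1 / real n) * (\<integral>x. (\<Sum>k<n. (snd (x k) -
          snd (g (f1 (\<lambda>k. fst (x k))) (f2 (\<lambda>k. snd (x k)))) k)^2) \<partial>PiM {..<n} (\<lambda>_. P)) \<le> d2 + \<delta> \<and>
      log 2 (real M1) / real n \<le> R1 + \<delta> \<and> log 2 (real M2) / real n \<le> R2 + \<delta>"
      unfolding achievable_def by blast
    \<comment> \<open>\<open>N\<close> itself could be 0, and the rates are divided by the block
      length.\<close>
    define n where "n = Suc N"
    have n: "0 < n" "N \<le> n" by (auto simp: n_def)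
    from N n(2) obtain M1 M2 :: nat and f1 f2 :: "(nat \<Rightarrow> real) \<Rightarrow> nat"
      and g :: "nat \<Rightarrow> nat \<Rightarrow> (nat \<Rightarrow> real) \<times> (nat \<Rightarrow> real)" where
      f: "\<And>u. f1 u \<in> {1..M1}" "\<And>u. f2 u \<in> {1..M2}" and
      m: "(\<lambda>x. f1 (\<lambda>k. fst (x k))) \<in> PiM {..<n} (\<lambda>_. P) \<rightarrow>\<^sub>M count_space UNIV"
         "(\<lambda>x. f2 (\<lambda>k. snd (x k))) \<in> PiM {..<n} (\<lambda>_. P) \<rightarrow>\<^sub>M count_space UNIV" and
      e: "(1 / real n) * (\<integral>x. (\<Sum>k<n. (fst (x k) -
          fst (g (f1 (\<lambda>k. fst (x k))) (f2 (\<lambda>k. snd (x k)))) k)^2) \<partial>PiM {..<n} (\<lambda>_. P)) \<le> d1 + \<delta>"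
         "(1 / real n) * (\<integral>x. (\<Sum>k<n. (snd (x k) -
          snd (g (f1 (\<lambda>k. fst (x k))) (f2 (\<lambda>k. snd (x k)))) k)^2) \<partial>PiM {..<n} (\<lambda>_. P)) \<le> d2 + \<delta>" and
      r: "log 2 (real M1) / real n \<le> R1 + \<delta>" "log 2 (real M2) / real n \<le> R2 + \<delta>"
      by blast
    define E1 where "E1 = (\<integral>x. (\<Sum>k<n. (fst (x k) -
          fst (g (f1 (\<lambda>k. fst (x k))) (f2 (\<lambda>k. snd (x k)))) k)^2) \<partial>PiM {..<n} (\<lambda>_. P))"
    define E2 where "E2 = (\<integral>x. (\<Sum>k<n. (snd (x k) -
          snd (g (f1 (\<lambda>k. fst (x k))) (f2 (\<lambda>k. snd (x k)))) k)^2) \<partial>PiM {..<n} (\<lambda>_. P))"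
    have E: "0 \<le> E1" "0 \<le> E2" unfolding E1_def E2_def
      by (auto intro!: Bochner_Integration.integral_nonneg sum_nonneg)
    have E': "E1 \<le> n * (d1 + \<delta>)" "E2 \<le> n * (d2 + \<delta>)"
      using e n unfolding E1_def[symmetric] E2_def[symmetric] by (simp_all add: field_simps)
    have "0 \<le> 1 / real n * E1" "0 \<le> 1 / real n * E2" using E by simp_all
    then have d: "0 \<le> d1 + \<delta>" "0 \<le> d2 + \<delta>"
      using e unfolding E1_def[symmetric] E2_def[symmetric] by linarith+
    \<comment> \<open>The permitted squared error plus the dither variance; with this choice each
      distortion term is at most \<open>n / 2\<close>.\<close>
    define V1 V2 where "V1 = d1 + \<delta> + D1" and "V2 = d2 + \<delta> + D2"
    have V: "0 < V1" "0 < V2" using d D1 D2 by (auto simp: V1_def V2_def)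
    define K where "K = ln (2 * pi * sqrt (V1 * V2) / cell_vol)"
    have "n * expectation ell \<le> ln M1 + ln M2 + n * K + (E1 + n * D1) / (2 * V1) + (E2 + n * D2) / (2 * V2)"
      unfolding E1_def E2_def K_def by (rule code_bound[OF f m V])
    moreover have "(E1 + n * D1) / (2 * V1) \<le> n / 2" "(E2 + n * D2) / (2 * V2) \<le> n / 2"
      using E' V by (simp_all add: V1_def V2_def field_simps)
    ultimately have 1: "n * expectation ell \<le> ln M1 + ln M2 + n * K + n" by linarith
    have "ln M1 \<le> n * ((R1 + \<delta>) * ln 2)" "ln M2 \<le> n * ((R2 + \<delta>) * ln 2)"
      using r n by (simp_all add: log_def field_simps)
    with 1 have "n * expectation ell \<le> n * ((R1 + \<delta>) * ln 2 + (R2 + \<delta>) * ln 2 + K + 1)"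
      by (simp add: algebra_simps)
    then have "expectation ell \<le> (R1 + \<delta>) * ln 2 + (R2 + \<delta>) * ln 2 + K + 1"
      using n by simp
    with entropy_le_expectation_ell
    have "ln 2 * H_Y1Y2_Z P D1 D2 \<le> (R1 + \<delta>) * ln 2 + (R2 + \<delta>) * ln 2 + K + 1" by linarith
    then have "H_Y1Y2_Z P D1 D2 \<le> R1 + R2 + 2 * \<delta> + (1 + K) / ln 2"
      by (simp add: field_simps)
    also have "(1 + K) / ln 2 = cconst (d1 + \<delta>) D1 + cconst (d2 + \<delta>) D2"
      unfolding K_def cconst_eq[OF V] by (simp add: V1_def V2_def)
    finally show ?thesis using d by simp
  qed
  \<comment> \<open>Nonnegativity in the limit keeps the arguments of the logarithms in
    \<open>cconst\<close> positive, hence \<open>cconst\<close> continuous there.\<close>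
  have d: "0 \<le> d1" "0 \<le> d2"
    by (rule field_le_epsilon; use step in force)+
  have cc: "((\<lambda>\<delta>. cconst (d + \<delta>) D) \<longlongrightarrow> cconst d D) (at_right 0)" if "0 \<le> d" "0 < D" for d D :: real
  proof -
    have p: "0 < pi * exp 1 / 6 * (d / D + 1)" using that by (intro mult_pos_pos add_nonneg_pos) auto
    have "((\<lambda>\<delta>. pi * exp 1 / 6 * ((d + \<delta>) / D + 1)) \<longlongrightarrow> pi * exp 1 / 6 * ((d + 0) / D + 1)) (at_right 0)"
      using that by (intro tendsto_intros) auto
    then show ?thesis unfolding cconst_def using p
      by (intro tendsto_mult[OF tendsto_const tendsto_log[OF tendsto_const]]) auto
  qed
  have "((\<lambda>\<delta>. R1 + R2 + 2 * \<delta> + cconst (d1 + \<delta>) D1 + cconst (d2 + \<delta>) D2) \<longlongrightarrow>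
      R1 + R2 + 2 * 0 + cconst d1 D1 + cconst d2 D2) (at_right 0)"
    by (intro tendsto_intros cc d D1 D2)
  moreover have "\<forall>\<^sub>F \<delta> in at_right 0. H_Y1Y2_Z P D1 D2 \<le> R1 + R2 + 2 * \<delta> + cconst (d1 + \<delta>) D1 + cconst (d2 + \<delta>) D2"
    using step by (auto simp: eventually_at_right_field intro: exI[of _ 1])
  ultimately show ?thesis
    using tendsto_lowerbound by fastforce
qed

end

section \<open>From the source density to the two claims\<close>

lemma bounded_source_src:
  fixes p :: "real \<times> real \<Rightarrow> real"
  assumes "p \<in> borel_measurable lborel" "\<And>x. 0 \<le> p x" "(\<integral>\<^sup>+x. ennreal (p x) \<partial>lborel) = 1"
    and supp: "\<And>x. x \<notin> {-A..A} \<times> {-A..A} \<Longrightarrow> p x = 0"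
    and "0 < D1" "0 < D2"
  shows "bounded_source (src p) A D1 D2"
proof -
  interpret prob_space "src p"
    by standard (use assms in \<open>simp add: src_def emeasure_density\<close>)
  show ?thesis
  proof
    show "sets (src p) = sets borel" by (simp add: src_def)
    have "\<bar>fst x\<bar> \<le> A \<and> \<bar>snd x\<bar> \<le> A" if "0 < ennreal (p x)" for x
      using supp[of x] that by (cases "x \<in> {-A..A} \<times> {-A..A}") (auto simp: abs_le_iff)
    then show "AE x in src p. \<bar>fst x\<bar> \<le> A \<and> \<bar>snd x\<bar> \<le> A"
      unfolding src_def using assms(1) by (subst AE_density) auto
  qed fact+
qed

theorem theorem3:
  fixes A D1 D2 :: real and p :: "real \<times> real \<Rightarrow> real"
  assumes p_meas: "p \<in> borel_measurable lborel"
    and p_nonneg: "\<And>x. 0 \<le> p x"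
    and p_total: "(\<integral>\<^sup>+x. ennreal (p x) \<partial>lborel) = 1"
    and p_supp: "\<And>x. x \<notin> {-A..A} \<times> {-A..A} \<Longrightarrow> p x = 0"
    and mean1: "(\<integral>x. fst x * p x \<partial>lborel) = 0"
    and mean2: "(\<integral>x. snd x * p x \<partial>lborel) = 0"
    and D1_pos: "0 < D1" and D2_pos: "0 < D2"
  shows "(\<forall>Rs1 Rs2 R1 R2.
            achievable (src p) (Dstar1 p D1 D2) (Dstar2 p D1 D2) Rs1 Rs2 \<and>
            (R1, R2) \<in> rate_region (src p) D1 D2 \<and>
            R1 \<in> rate_interval1 (src p) D1 D2 \<and>
            R1 + R2 = H_Y1Y2_Z (src p) D1 D2 \<longrightarrow>
            R1 + R2 \<le> Rs1 + Rs2 + cconst (Dstar1 p D1 D2) D1 + cconst (Dstar2 p D1 D2) D2)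
       \<and> (\<forall>Rs1 Rs2.
            achievable (src p) (Dstar1 p D1 D2) (Dstar2 p D1 D2) Rs1 Rs2 \<and>
            Rs1 \<in> rate_interval1 (src p) D1 D2 \<longrightarrow>
            (\<exists>R1 R2. (R1, R2) \<in> rate_region (src p) D1 D2 \<and> R1 = Rs1 \<and>
               R2 \<le> Rs2 + cconst (Dstar1 p D1 D2) D1 + cconst (Dstar2 p D1 D2) D2))"
proof -
  interpret bounded_source "src p" A D1 D2
    by (rule bounded_source_src[OF p_meas p_nonneg p_total p_supp D1_pos D2_pos])
  show ?thesis
  proof (intro conjI allI impI)
    fix Rs1 Rs2 R1 R2
    assume "achievable (src p) (Dstar1 p D1 D2) (Dstar2 p D1 D2) Rs1 Rs2 \<and>
            (R1, R2) \<in> rate_region (src p) D1 D2 \<and>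
            R1 \<in> rate_interval1 (src p) D1 D2 \<and>
            R1 + R2 = H_Y1Y2_Z (src p) D1 D2"
    then show "R1 + R2 \<le> Rs1 + Rs2 + cconst (Dstar1 p D1 D2) D1 + cconst (Dstar2 p D1 D2) D2"
      using achievable_bound by metis
  next
    fix Rs1 Rs2
    assume "achievable (src p) (Dstar1 p D1 D2) (Dstar2 p D1 D2) Rs1 Rs2 \<and>
            Rs1 \<in> rate_interval1 (src p) D1 D2"
    then have b: "H_Y1Y2_Z (src p) D1 D2 \<le> Rs1 + Rs2 + cconst (Dstar1 p D1 D2) D1 + cconst (Dstar2 p D1 D2) D2"
      and i: "H_Y1_Y2Z (src p) D1 D2 \<le> Rs1" "Rs1 \<le> H_Y1_Z1 (src p) D1"
      using achievable_bound by (auto simp: rate_interval1_def)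
    \<comment> \<open>The sum constraint holds with equality. By the chain rule, the upper end
      \<open>H_Y1_Z1\<close> of the interval is exactly the lower bound \<open>H_Y2_Y1Z\<close> on
      the second rate.\<close>
    have "(Rs1, H_Y1Y2_Z (src p) D1 D2 - Rs1) \<in> rate_region (src p) D1 D2"
      using i entropy_chain_rule by (simp add: rate_region_def)
    moreover have "H_Y1Y2_Z (src p) D1 D2 - Rs1 \<le> Rs2 + cconst (Dstar1 p D1 D2) D1 + cconst (Dstar2 p D1 D2) D2"
      using b by simp
    ultimately show "\<exists>R1 R2. (R1, R2) \<in> rate_region (src p) D1 D2 \<and> R1 = Rs1 \<and>
               R2 \<le> Rs2 + cconst (Dstar1 p D1 D2) D1 + cconst (Dstar2 p D1 D2) D2"
      by blast
  qed
qed

end
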